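(* Let $k$ be an arbitrary field, $Q$ a finitely generated commutative monoid, $I\subseteq k[Q]$ a binomial ideal, and $\mathfrak p=I_{\sigma,P}$ a binomial prime ideal of $k[Q]$ (with $P\subset Q$ a prime ideal and $\sigma$ a character on a subgroup of $G_P$). Then the kernel of the natural homomorphism from $k[Q]$ to the ordinary localization $(k[Q]/I)_{\mathfrak p}$ contains the binomial localization $I+M_\infty^P(I)+M_\sigma^P(I)$.
   Context: $k[Q]=\bigoplus_q k\,t^q$; binomial ideals generated by $t^p-\lambda t^q$; $\sim_I$: $p\sim_I q$ iff $t^p-\lambda t^q\in I$ for some $\lambda\in k^*$. Prime ideals $P$ of $Q$ ($\varnothing$ prime iff $Q$ has no nil); $Q_P$ the localization (differences $a-u$, $u\notin P$), $G_P$ its unit group, $k[Q]_P=k[Q_P]$, $I_P=Ik[Q]_P$, $\mathfrak m_P=\langle t^p:p\in P_P\rangle$; $\bar Q_P$ the localization of $Q/\sim_I$ at the image of $Q\setminus P$. For $K\subseteq G_P$ and $\rho:K\to k^*$: $I_\rho=\langle t^{g+v}-\rho(g)t^v: g\in K,v\in Q_P\rangle\subseteq k[Q]_P$, $I_{\rho,P}$ = preimage in $k[Q]$ of $I_\rho+\mathfrak m_P$. For $q\in Q$ with $t^q\notin I_P$: $K_q^P=\{g\in G_P:\overline{g+q}=\bar q\text{ in }\bar Q_P\}$ and the character of $I_P$ at $q$ is $\rho_q^P:K_q^P\to k^*$ with $(I_P:t^q)+\mathfrak m_P=I_{\rho_q^P}+\mathfrak m_P$. The \emph{$P$-infinite ideal}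 $M_\infty^P(I)\subseteq k[Q]$ is generated by monomials $t^q$ such that $\overline{q+p}=\bar q$ in $\bar Q_P$ for some $p\in P$. The \emph{incommensurate ideal} $M_\sigma^P(I)$ is spanned over $k$ by the monomials $t^q$ with $t^q\notin I_P$ such that $\rho_q^P$ is not a restriction of $\sigma$ (i.e. either $K_q^P\not\subseteq$ domain of $\sigma$, or $\rho_q^P\neq\sigma|_{K_q^P}$), together with those $t^q\in I_P$. *)

theory Defs
  imports Main "HOL-Library.Poly_Mapping"
begin

definition is_ideal :: "'r::comm_ring_1 set \<Rightarrow> bool" where
  "is_ideal J \<longleftrightarrow> 0 \<in> J \<and> (\<forall>a\<in>J. \<forall>b\<in>J. a + b \<in> J) \<and> (\<forall>r. \<forall>a\<in>J. r * a \<in> J)"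

definition gen_ideal :: "'r::comm_ring_1 set \<Rightarrow> 'r set" where
  "gen_ideal S = \<Inter>{J. is_ideal J \<and> S \<subseteq> J}"

(* k[Q] is the type ('q \<Rightarrow>\<^sub>0 'k) of finitely supported functions with convolution
  product (HOL-Library.Poly_Mapping); the monomial t^q is single q 1. *)

abbreviation mono :: "'q::comm_monoid_add \<Rightarrow> ('q \<Rightarrow>\<^sub>0 'k::field)" where
  "mono q \<equiv> Poly_Mapping.single q 1"

inductive_set mon_gen :: "'q::comm_monoid_add set \<Rightarrow> 'q set" for A where
  zero: "0 \<in> mon_gen A"
| add: "a \<in> A \<Longrightarrow> x \<in> mon_gen A \<Longrightarrow> a + x \<in> mon_gen A"

definition fin_gen_monoid :: "'q::comm_monoid_add itself \<Rightarrow> bool" where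
  "fin_gen_monoid _ \<longleftrightarrow> (\<exists>A::'q set. finite A \<and> mon_gen A = UNIV)"

definition binomial_ideal :: "('q::comm_monoid_add \<Rightarrow>\<^sub>0 'k::field) set \<Rightarrow> bool" where
  "binomial_ideal I \<longleftrightarrow> (\<exists>B. I = gen_ideal B \<and>
     (\<forall>b\<in>B. \<exists>p q c. b = mono p - Poly_Mapping.single q c))"

definition simI :: "('q::comm_monoid_add \<Rightarrow>\<^sub>0 'k::field) set \<Rightarrow> 'q \<Rightarrow> 'q \<Rightarrow> bool" where
  "simI I p q \<longleftrightarrow> (\<exists>c. c \<noteq> 0 \<and> mono p - Poly_Mapping.single q c \<in> I)"

definition has_nil :: "'q::comm_monoid_add itself \<Rightarrow> bool" where
  "has_nil _ \<longleftrightarrow> (\<exists>n::'q. \<forall>q. n + q = n)"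

definition monoid_prime :: "'q::comm_monoid_add set \<Rightarrow> bool" where
  "monoid_prime P \<longleftrightarrow> P \<noteq> UNIV \<and> (\<forall>p\<in>P. \<forall>q. p + q \<in> P) \<and>
     (\<forall>a b. a + b \<in> P \<longrightarrow> a \<in> P \<or> b \<in> P) \<and> (P = {} \<longrightarrow> \<not> has_nil TYPE('q))"

(* == The localization Q_P (differences a - u with u \<notin> P), as a set of classes of pairs == *)

definition locrel :: "'q::comm_monoid_add set \<Rightarrow> (('q \<times> 'q) \<times> ('q \<times> 'q)) set" where
  "locrel P = {((a, u), (b, v)). u \<notin> P \<and> v \<notin> P \<and> (\<exists>w. w \<notin> P \<and> a + v + w = b + u + w)}"

definition lcls :: "'q::comm_monoid_add set \<Rightarrow> 'q \<Rightarrow> 'q \<Rightarrow> ('q \<times> 'q) set" where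
  "lcls P a u = locrel P `` {(a, u)}"

definition QP :: "'q::comm_monoid_add set \<Rightarrow> ('q \<times> 'q) set set" where
  "QP P = (UNIV \<times> (- P)) // locrel P"

definition ladd :: "'q::comm_monoid_add set \<Rightarrow> ('q \<times> 'q) set \<Rightarrow> ('q \<times> 'q) set \<Rightarrow> ('q \<times> 'q) set" where
  "ladd P X Y = (\<Union>(a, u)\<in>X. \<Union>(b, v)\<in>Y. lcls P (a + b) (u + v))"

definition lzero :: "'q::comm_monoid_add set \<Rightarrow> ('q \<times> 'q) set" where
  "lzero P = lcls P 0 0"

definition GP :: "'q::comm_monoid_add set \<Rightarrow> ('q \<times> 'q) set set" where
  "GP P = {X \<in> QP P. \<exists>Y\<in>QP P. ladd P X Y = lzero P}"

definition PP :: "'q::comm_monoid_add set \<Rightarrow> ('q \<times> 'q) set set" where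
  "PP P = {lcls P a u | a u. a \<in> P \<and> u \<notin> P}"

definition subgroup_GP :: "'q::comm_monoid_add set \<Rightarrow> ('q \<times> 'q) set set \<Rightarrow> bool" where
  "subgroup_GP P K \<longleftrightarrow> K \<subseteq> GP P \<and> lzero P \<in> K \<and> (\<forall>g\<in>K. \<forall>h\<in>K. ladd P g h \<in> K) \<and>
     (\<forall>g\<in>K. \<exists>h\<in>K. ladd P g h = lzero P)"

definition is_character :: "'q::comm_monoid_add set \<Rightarrow> ('q \<times> 'q) set set \<Rightarrow> (('q \<times> 'q) set \<Rightarrow> 'k::field) \<Rightarrow> bool" where
  "is_character P K \<rho> \<longleftrightarrow> subgroup_GP P K \<and> (\<forall>g\<in>K. \<rho> g \<noteq> 0) \<and>
     (\<forall>g\<in>K. \<forall>h\<in>K. \<rho> (ladd P g h) = \<rho> g * \<rho> h)"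

(* == The monoid algebra k[Q]_P = k[Q_P]: finitely supported functions on Q_P == *)

definition supp :: "('a \<Rightarrow> 'k::zero) \<Rightarrow> 'a set" where
  "supp c = {X. c X \<noteq> 0}"

definition RP :: "'q::comm_monoid_add set \<Rightarrow> (('q \<times> 'q) set \<Rightarrow> 'k::field) set" where
  "RP P = {c. finite (supp c) \<and> supp c \<subseteq> QP P}"

definition lmul :: "'q::comm_monoid_add set \<Rightarrow> (('q \<times> 'q) set \<Rightarrow> 'k::field)
     \<Rightarrow> (('q \<times> 'q) set \<Rightarrow> 'k) \<Rightarrow> (('q \<times> 'q) set \<Rightarrow> 'k)" where
  "lmul P c d = (\<lambda>Z. \<Sum>X\<in>supp c. \<Sum>Y\<in>supp d. if ladd P X Y = Z then c X * d Y else 0)"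

definition lmon :: "('q \<times> 'q) set \<Rightarrow> (('q \<times> 'q) set \<Rightarrow> 'k::field)" where
  "lmon X = (\<lambda>Y. if Y = X then 1 else 0)"

definition lideal :: "'q::comm_monoid_add set \<Rightarrow> (('q \<times> 'q) set \<Rightarrow> 'k::field) set \<Rightarrow> bool" where
  "lideal P J \<longleftrightarrow> J \<subseteq> RP P \<and> (\<lambda>_. 0) \<in> J \<and> (\<forall>a\<in>J. \<forall>b\<in>J. (\<lambda>X. a X + b X) \<in> J) \<and>
     (\<forall>r\<in>RP P. \<forall>a\<in>J. lmul P r a \<in> J)"

definition lgen :: "'q::comm_monoid_add set \<Rightarrow> (('q \<times> 'q) set \<Rightarrow> 'k::field) set
     \<Rightarrow> (('q \<times> 'q) set \<Rightarrow> 'k) set" where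
  "lgen P S = \<Inter>{J. lideal P J \<and> S \<subseteq> J}"

definition lsum :: "('a \<Rightarrow> 'k::field) set \<Rightarrow> ('a \<Rightarrow> 'k) set \<Rightarrow> ('a \<Rightarrow> 'k) set" where
  "lsum J1 J2 = {(\<lambda>X. a X + b X) | a b. a \<in> J1 \<and> b \<in> J2}"

definition lemb :: "'q::comm_monoid_add set \<Rightarrow> ('q \<Rightarrow>\<^sub>0 'k::field) \<Rightarrow> (('q \<times> 'q) set \<Rightarrow> 'k)" where
  "lemb P f = (\<lambda>X. \<Sum>q\<in>Poly_Mapping.keys f. if lcls P q 0 = X then Poly_Mapping.lookup f q else 0)"

definition IP :: "'q::comm_monoid_add set \<Rightarrow> ('q \<Rightarrow>\<^sub>0 'k::field) set \<Rightarrow> (('q \<times> 'q) set \<Rightarrow> 'k) set" where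
  "IP P I = lgen P (lemb P ` I)"

definition mP :: "'q::comm_monoid_add set \<Rightarrow> (('q \<times> 'q) set \<Rightarrow> 'k::field) set" where
  "mP P = lgen P (lmon ` PP P)"

definition Irho :: "'q::comm_monoid_add set \<Rightarrow> ('q \<times> 'q) set set \<Rightarrow> (('q \<times> 'q) set \<Rightarrow> 'k::field)
     \<Rightarrow> (('q \<times> 'q) set \<Rightarrow> 'k) set" where
  "Irho P K \<rho> = lgen P {(\<lambda>Y. lmon (ladd P g v) Y - \<rho> g * lmon v Y) | g v. g \<in> K \<and> v \<in> QP P}"

definition IrhoP :: "'q::comm_monoid_add set \<Rightarrow> ('q \<times> 'q) set set \<Rightarrow> (('q \<times> 'q) set \<Rightarrow> 'k::field)
     \<Rightarrow> ('q \<Rightarrow>\<^sub>0 'k) set" where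
  "IrhoP P K \<rho> = {f. lemb P f \<in> lsum (Irho P K \<rho>) (mP P)}"

definition lcolon :: "'q::comm_monoid_add set \<Rightarrow> (('q \<times> 'q) set \<Rightarrow> 'k::field) set \<Rightarrow> 'q
     \<Rightarrow> (('q \<times> 'q) set \<Rightarrow> 'k) set" where
  "lcolon P J q = {c \<in> RP P. lmul P c (lmon (lcls P q 0)) \<in> J}"

(* == The localization \<bar>Q_P of Q/\<sim>_I at the image of Q \<setminus> P == *)

definition barrel :: "('q::comm_monoid_add \<Rightarrow>\<^sub>0 'k::field) set \<Rightarrow> 'q set \<Rightarrow> (('q \<times> 'q) \<times> ('q \<times> 'q)) set" where
  "barrel I P = {((a, u), (b, v)). u \<notin> P \<and> v \<notin> P \<and> (\<exists>w. w \<notin> P \<and> simI I (a + v + w) (b + u + w))}"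

(* Image in \<bar>Q_P of an element X of Q_P (the class of a - u is barrel `` {(a,u)}). *)
definition qbar :: "('q::comm_monoid_add \<Rightarrow>\<^sub>0 'k::field) set \<Rightarrow> 'q set \<Rightarrow> ('q \<times> 'q) set \<Rightarrow> ('q \<times> 'q) set" where
  "qbar I P X = barrel I P `` X"

definition Kq :: "('q::comm_monoid_add \<Rightarrow>\<^sub>0 'k::field) set \<Rightarrow> 'q set \<Rightarrow> 'q \<Rightarrow> ('q \<times> 'q) set set" where
  "Kq I P q = {g \<in> GP P. qbar I P (ladd P g (lcls P q 0)) = qbar I P (lcls P q 0)}"

definition rhoq :: "('q::comm_monoid_add \<Rightarrow>\<^sub>0 'k::field) set \<Rightarrow> 'q set \<Rightarrow> 'q \<Rightarrow> (('q \<times> 'q) set \<Rightarrow> 'k)" where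
  "rhoq I P q = (THE \<rho>. is_character P (Kq I P q) \<rho> \<and> (\<forall>g. g \<notin> Kq I P q \<longrightarrow> \<rho> g = undefined) \<and>
       lsum (lcolon P (IP P I) q) (mP P) = lsum (Irho P (Kq I P q) \<rho>) (mP P))"

definition Minf :: "'q::comm_monoid_add set \<Rightarrow> ('q \<Rightarrow>\<^sub>0 'k::field) set \<Rightarrow> ('q \<Rightarrow>\<^sub>0 'k) set" where
  "Minf P I = gen_ideal {mono q | q. \<exists>p\<in>P. qbar I P (lcls P (q + p) 0) = qbar I P (lcls P q 0)}"

definition mono_span :: "'q set \<Rightarrow> ('q \<Rightarrow>\<^sub>0 'k::field) set" where
  "mono_span S = {\<Sum>q\<in>A. Poly_Mapping.single q (c q) | A c. finite A \<and> A \<subseteq> S}"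

definition Msigma :: "'q::comm_monoid_add set \<Rightarrow> ('q \<times> 'q) set set \<Rightarrow> (('q \<times> 'q) set \<Rightarrow> 'k::field)
     \<Rightarrow> ('q \<Rightarrow>\<^sub>0 'k) set \<Rightarrow> ('q \<Rightarrow>\<^sub>0 'k) set" where
  "Msigma P L \<sigma> I = mono_span {q. (lemb P (mono q) \<notin> IP P I \<and>
        \<not> (Kq I P q \<subseteq> L \<and> (\<forall>g\<in>Kq I P q. rhoq I P q g = \<sigma> g)))
      \<or> lemb P (mono q) \<in> IP P I}"

(* f maps to 0 in the ordinary localization (k[Q]/I)_pr iff s \<cdot> f \<in> I for some s \<notin> pr
  (definition of equality of fractions in S^{-1}(k[Q]/I)). *)
definition loc_kernel :: "'r::comm_ring_1 set \<Rightarrow> 'r set \<Rightarrow> 'r set" where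
  "loc_kernel I pr = {f. \<exists>s. s \<notin> pr \<and> s * f \<in> I}"

definition is_prime_ideal :: "'r::comm_ring_1 set \<Rightarrow> bool" where
  "is_prime_ideal pr \<longleftrightarrow> is_ideal pr \<and> pr \<noteq> UNIV \<and> (\<forall>a b. a * b \<in> pr \<longrightarrow> a \<in> pr \<or> b \<in> pr)"

end

theory Submission
  imports Defs
begin

text \<open>
  Let \<open>\<pp> = I\<^bsub>\<sigma>,P\<^esub>\<close>. It suffices to multiply each generating monomial \<open>t\<^sup>q\<close> into \<open>I\<close> by an
  element outside \<open>\<pp>\<close>. If \<open>q + p \<sim> q\<close> with \<open>p \<in> P\<close>, a binomial \<open>t\<^bsup>p+w\<^esup> - c t\<^sup>w\<close> with \<open>w \<notin> P\<close> does it;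
  if \<open>t\<^sup>q \<in> I\<^sub>P\<close>, a monomial \<open>t\<^sup>w\<close> with \<open>w \<notin> P\<close> does it. In the incommensurate case argue by contraposition:
  if \<open>(I : t\<^sup>q) \<subseteq> \<pp>\<close>, then every binomial of \<open>I\<close> witnessing \<open>g \<in> K\<^sub>q\<close> yields
  \<open>t\<^sup>a - c t\<^sup>u \<in> \<pp>\<close> with \<open>g = a - u\<close>, which forces \<open>g\<close> into the domain of \<open>\<sigma>\<close> and \<open>c = \<sigma> g\<close>. Hence
  the restriction of \<open>\<sigma>\<close> is the character of \<open>I\<^sub>P\<close> at \<open>q\<close>. Non-membership in \<open>I\<^sub>\<rho> + \<mm>\<^sub>P\<close> is detected by
  linear functionals on \<open>k[Q\<^sub>P]\<close> that vanish on \<open>P\<^sub>P\<close> and are \<open>\<rho>\<close>-equivariant, for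
  instance the extension of \<open>\<rho>\<close> by zero.

  The character of \<open>I\<^sub>P\<close> at \<open>q\<close> is not defined for all \<open>q\<close> with \<open>t\<^sup>q \<notin> I\<^sub>P\<close>: if \<open>q + p \<sim> q\<close> with
  \<open>p \<in> P\<close>, then \<open>(I\<^sub>P : t\<^sup>q) + \<mm>\<^sub>P\<close> is the unit ideal and \<open>rhoq\<close> is a junk value. The contraposition
  avoids this, since such \<open>t\<^sup>q\<close> are multiplied into \<open>I\<close> from outside \<open>\<pp>\<close> anyway.
\<close>

subsection \<open>Pairing with functions on the exponents\<close>

lemma pm_sum_singles:
  "f = (\<Sum>q\<in>Poly_Mapping.keys f. Poly_Mapping.single q (Poly_Mapping.lookup f q))"
  by (rule poly_mapping_eqI) (auto simp: lookup_sum lookup_single when_def in_keys_iff)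

lemma pm_induct [case_names zero single add]:
  fixes f :: "'a \<Rightarrow>\<^sub>0 'k::comm_monoid_add"
  assumes "R 0" and "\<And>q c. R (Poly_Mapping.single q c)"
    and "\<And>f g. R f \<Longrightarrow> R g \<Longrightarrow> R (f + g)"
  shows "R f"
proof -
  have sums: "R (\<Sum>q\<in>A. Poly_Mapping.single q (c q))" if "finite A" for A and c :: "'a \<Rightarrow> 'k"
    using that by (induction A rule: finite_induct) (auto intro: assms)
  show ?thesis
    using sums[of "Poly_Mapping.keys f" "Poly_Mapping.lookup f"] by (simp flip: pm_sum_singles)
qed

text \<open>The linear functional on k[Q] with value \<open>\<phi> q\<close> on the monomial at
  \<open>q\<close>. Coefficients of fractions are defined through it as well, so
  \<open>fpair_mult\<close> also governs products of fractions.\<close>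

definition fpair :: "('a \<Rightarrow>\<^sub>0 'k::field) \<Rightarrow> ('a \<Rightarrow> 'k) \<Rightarrow> 'k" where
  "fpair f \<phi> = (\<Sum>q\<in>Poly_Mapping.keys f. Poly_Mapping.lookup f q * \<phi> q)"

lemma fpair_superset:
  assumes "finite A" "Poly_Mapping.keys f \<subseteq> A"
  shows "fpair f \<phi> = (\<Sum>q\<in>A. Poly_Mapping.lookup f q * \<phi> q)"
  unfolding fpair_def using assms
  by (intro sum.mono_neutral_left) (auto simp: in_keys_iff)

lemma fpair_0 [simp]: "fpair 0 \<phi> = 0"
  by (simp add: fpair_def)

lemma fpair_zero_fun [simp]: "fpair f (\<lambda>_. 0) = 0"
  by (simp add: fpair_def)

lemma fpair_single [simp]: "fpair (Poly_Mapping.single q c) \<phi> = c * \<phi> q"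
  by (simp add: fpair_def)

lemma fpair_add: "fpair (f + g) \<phi> = fpair f \<phi> + fpair g \<phi>"
proof -
  let ?A = "Poly_Mapping.keys f \<union> Poly_Mapping.keys g"
  have "finite ?A" by simp
  then show ?thesis
    using fpair_superset[of ?A f \<phi>] fpair_superset[of ?A g \<phi>]
      fpair_superset[of ?A "f + g" \<phi>] keys_add[of f g]
    by (simp add: lookup_add distrib_right sum.distrib)
qed

lemma fpair_diff: "fpair (f - g) \<phi> = fpair f \<phi> - fpair g \<phi>"
  using fpair_add[of "f - g" g \<phi>] by simp

text \<open>Both sides are bilinear in \<open>f\<close> and \<open>g\<close>, and they agree on
  pairs of monomials.\<close>

lemma fpair_mult:
  fixes f g :: "'a::comm_monoid_add \<Rightarrow>\<^sub>0 'k::field"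
  shows "fpair (f * g) \<phi> = fpair f (\<lambda>p. fpair g (\<lambda>q. \<phi> (p + q)))"
proof (induction f rule: pm_induct)
  case (single p c)
  show ?case
    by (induction g rule: pm_induct)
      (simp_all add: mult_single distrib_left fpair_add mult.assoc)
qed (simp_all add: distrib_right fpair_add)

text \<open>Deleting the key \<open>b\<close> and changing the coefficient at the key
  \<open>p\<close> creates no new key. This is the decrease behind both inductions on the number of
  terms.\<close>

lemma card_keys_merge_less:
  assumes "p \<in> Poly_Mapping.keys s" "b \<in> Poly_Mapping.keys s" "p \<noteq> b"
  shows "card (Poly_Mapping.keys (s - Poly_Mapping.single b (Poly_Mapping.lookup s b)
      + Poly_Mapping.single p c)) < card (Poly_Mapping.keys s)"
    (is "card (Poly_Mapping.keys ?t) < _")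
proof (rule psubset_card_mono)
  have "Poly_Mapping.keys ?t \<subseteq> Poly_Mapping.keys s - {b}"
    using assms
    by (auto simp: in_keys_iff lookup_add lookup_minus lookup_single when_def split: if_splits)
  with assms show "Poly_Mapping.keys ?t \<subset> Poly_Mapping.keys s" by blast
qed simp

section \<open>Pairing and fractions in the localized algebra\<close>

definition lpair :: "('a \<Rightarrow> 'k::field) \<Rightarrow> ('a \<Rightarrow> 'k) \<Rightarrow> 'k" where
  "lpair c \<chi> = (\<Sum>X\<in>supp c. c X * \<chi> X)"

text \<open>The fraction \<open>f / t\<^sup>u\<close> in \<open>k[Q\<^sub>P]\<close>.\<close>

definition lfrac :: "'q::comm_monoid_add set \<Rightarrow> 'q \<Rightarrow> ('q \<Rightarrow>\<^sub>0 'k::field) \<Rightarrow> ('q \<times> 'q) set \<Rightarrow> 'k" where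
  "lfrac P u f = (\<lambda>X. fpair f (\<lambda>q. if lcls P q u = X then 1 else 0))"

lemma lemb_eq_lfrac: "lemb P f = lfrac P 0 f"
  by (auto simp: lemb_def lfrac_def fpair_def fun_eq_iff intro!: sum.cong)

lemma lmon_eq_lfrac: "lmon (lcls P a u) = lfrac P u (mono a)"
  by (auto simp: lmon_def lfrac_def fun_eq_iff)

lemma lfrac_0: "lfrac P u 0 = (\<lambda>_. 0)"
  by (simp add: lfrac_def)

lemma lfrac_add: "lfrac P u (f + g) = (\<lambda>X. lfrac P u f X + lfrac P u g X)"
  by (simp add: lfrac_def fpair_add)

lemma lfrac_diff: "lfrac P u (f - g) = (\<lambda>X. lfrac P u f X - lfrac P u g X)"
  by (simp add: lfrac_def fpair_diff)

lemma lfrac_single: "lfrac P u (Poly_Mapping.single q c) = (\<lambda>X. c * lmon (lcls P q u) X)"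
  by (auto simp: lfrac_def lmon_def)

lemma supp_lfrac: "supp (lfrac P u f) \<subseteq> (\<lambda>q. lcls P q u) ` Poly_Mapping.keys f"
proof -
  have "lfrac P u f X = 0" if "X \<notin> (\<lambda>q. lcls P q u) ` Poly_Mapping.keys f" for X
    unfolding lfrac_def fpair_def using that by (intro sum.neutral) auto
  then show ?thesis by (auto simp: supp_def)
qed

text \<open>Exponents of the same class feed the same coefficient; interchanging the two sums
  regroups them. Functionals on the localized algebra are thus computed on numerators.\<close>

lemma lpair_lfrac: "lpair (lfrac P u f) \<chi> = fpair f (\<lambda>q. \<chi> (lcls P q u))"
proof -
  let ?K = "Poly_Mapping.keys f" and ?A = "(\<lambda>q. lcls P q u) ` Poly_Mapping.keys f"
  have "lpair (lfrac P u f) \<chi> = (\<Sum>X\<in>?A. lfrac P u f X * \<chi> X)"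
    unfolding lpair_def using supp_lfrac[of P u f]
    by (intro sum.mono_neutral_left) (auto simp: supp_def)
  also have "\<dots> = (\<Sum>X\<in>?A. \<Sum>q\<in>?K. if lcls P q u = X then Poly_Mapping.lookup f q * \<chi> X else 0)"
    by (auto simp: lfrac_def fpair_def sum_distrib_right intro!: sum.cong)
  also have "\<dots> = (\<Sum>q\<in>?K. \<Sum>X\<in>?A. if lcls P q u = X then Poly_Mapping.lookup f q * \<chi> X else 0)"
    by (rule sum.swap)
  also have "\<dots> = fpair f (\<lambda>q. \<chi> (lcls P q u))"
    by (auto simp: fpair_def intro!: sum.cong)
  finally show ?thesis .
qed

lemma lmul_eq_lpair:
  "lmul P c d Z = lpair c (\<lambda>X. lpair d (\<lambda>Y. if ladd P X Y = Z then 1 else 0))"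
  by (auto simp: lmul_def lpair_def sum_distrib_left mult.assoc intro!: sum.cong)

subsection \<open>Ideals and binomials\<close>

lemma ideal_minus: "is_ideal J \<Longrightarrow> a \<in> J \<Longrightarrow> b \<in> J \<Longrightarrow> a - b \<in> J"
  unfolding is_ideal_def by (metis diff_conv_add_uminus mult_minus1)

lemma is_ideal_gen_ideal: "is_ideal (gen_ideal S)"
  unfolding gen_ideal_def is_ideal_def by blast

lemma gen_ideal_least: "is_ideal J \<Longrightarrow> S \<subseteq> J \<Longrightarrow> gen_ideal S \<subseteq> J"
  unfolding gen_ideal_def by blast

lemma ideal_mult: "is_ideal J \<Longrightarrow> a \<in> J \<Longrightarrow> r * a \<in> J"
  by (simp add: is_ideal_def)

lemma ideal_add: "is_ideal J \<Longrightarrow> a \<in> J \<Longrightarrow> b \<in> J \<Longrightarrow> a + b \<in> J"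
  by (simp add: is_ideal_def)

lemma simI_refl: "is_ideal I \<Longrightarrow> simI I p p"
  unfolding simI_def by (rule exI[of _ 1]) (simp add: is_ideal_def)

lemma simI_sym:
  assumes "is_ideal I" "simI I p q" shows "simI I q p"
proof -
  obtain c where c: "c \<noteq> 0" "mono p - Poly_Mapping.single q c \<in> I"
    using assms by (auto simp: simI_def)
  have "Poly_Mapping.single 0 (- inverse c) * (mono p - Poly_Mapping.single q c)
      = mono q - Poly_Mapping.single p (inverse c)"
    using c by (simp add: right_diff_distrib mult_single single_uminus)
  then have "mono q - Poly_Mapping.single p (inverse c) \<in> I"
    using ideal_mult[OF assms(1) c(2)] by metis
  then show ?thesis unfolding simI_def using c by (metis inverse_nonzero_iff_nonzero)
qed

lemma simI_trans:
  assumes "is_ideal I" "simI I p q" "simI I q r" shows "simI I p r"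
proof -
  obtain c d where c: "c \<noteq> 0" "mono p - Poly_Mapping.single q c \<in> I"
    and d: "d \<noteq> 0" "mono q - Poly_Mapping.single r d \<in> I"
    using assms by (auto simp: simI_def)
  have "(mono p - Poly_Mapping.single q c) + Poly_Mapping.single 0 c * (mono q - Poly_Mapping.single r d)
      = mono p - Poly_Mapping.single r (c * d)"
    by (simp add: right_diff_distrib mult_single)
  moreover have "(mono p - Poly_Mapping.single q c)
      + Poly_Mapping.single 0 c * (mono q - Poly_Mapping.single r d) \<in> I"
    using c d assms by (intro ideal_add ideal_mult)
  ultimately have "mono p - Poly_Mapping.single r (c * d) \<in> I" by metis
  then show ?thesis unfolding simI_def using c d by (intro exI[of _ "c * d"]) simp
qed

lemma simI_add:
  assumes "is_ideal I" "simI I p q" shows "simI I (r + p) (r + q)"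
proof -
  obtain c where c: "c \<noteq> 0" "mono p - Poly_Mapping.single q c \<in> I"
    using assms by (auto simp: simI_def)
  have "mono r * (mono p - Poly_Mapping.single q c) \<in> I" using assms c by (intro ideal_mult)
  then show ?thesis unfolding simI_def using c by (auto simp: right_diff_distrib mult_single)
qed

section \<open>Splitting polynomials along unions of congruence classes\<close>

definition restr :: "'a set \<Rightarrow> ('a \<Rightarrow>\<^sub>0 'k::zero) \<Rightarrow> ('a \<Rightarrow>\<^sub>0 'k)" where
  "restr S f = Poly_Mapping.mapp (\<lambda>k v. v when k \<in> S) f"

lemma lookup_restr: "Poly_Mapping.lookup (restr S f) k = (Poly_Mapping.lookup f k when k \<in> S)"
  by (auto simp: restr_def lookup_mapp when_def in_keys_iff)

lemma restr_0 [simp]: "restr S 0 = 0"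
  by (rule poly_mapping_eqI) (simp add: lookup_restr)

lemma restr_add: "restr S (f + g) = restr S f + restr S (g :: 'a \<Rightarrow>\<^sub>0 'k::comm_monoid_add)"
  by (rule poly_mapping_eqI) (auto simp: lookup_restr lookup_add when_def)

lemma restr_diff: "restr S (f - g) = restr S f - restr S (g :: 'a \<Rightarrow>\<^sub>0 'k::ab_group_add)"
  by (rule poly_mapping_eqI) (auto simp: lookup_restr lookup_minus when_def)

lemma restr_single: "restr S (Poly_Mapping.single q c) = (if q \<in> S then Poly_Mapping.single q c else 0)"
  by (rule poly_mapping_eqI) (auto simp: lookup_restr lookup_single when_def)

lemma restr_single_mult:
  fixes f :: "'a::comm_monoid_add \<Rightarrow>\<^sub>0 'k::field"
  shows "restr S (Poly_Mapping.single r c * f) = Poly_Mapping.single r c * restr {y. r + y \<in> S} f"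
  by (induction f rule: pm_induct)
    (simp_all add: mult_single restr_single restr_add distrib_left)

text \<open>A binomial ideal is graded by the classes of \<open>simI I\<close>: a generator with two
  nonzero terms has both exponents in one class, so a saturated set keeps it whole or kills
  it.\<close>

lemma binomial_ideal_restr:
  fixes I :: "('q::comm_monoid_add \<Rightarrow>\<^sub>0 'k::field) set"
  assumes "binomial_ideal I" "f \<in> I" and S: "\<And>p q. simI I p q \<Longrightarrow> p \<in> S \<longleftrightarrow> q \<in> S"
  shows "restr S f \<in> I"
proof -
  obtain B where B: "I = gen_ideal B" "\<And>b. b \<in> B \<Longrightarrow> \<exists>p q c. b = mono p - Poly_Mapping.single q c"
    using assms(1) by (auto simp: binomial_ideal_def)
  have I: "is_ideal I" unfolding B by (rule is_ideal_gen_ideal)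
  have BI: "B \<subseteq> I" unfolding B gen_ideal_def by blast
  define sat where "sat S \<longleftrightarrow> (\<forall>p q. simI I p q \<longrightarrow> (p \<in> S \<longleftrightarrow> q \<in> S))" for S
  \<comment> \<open>Quantifying over all saturated sets makes \<open>J\<close> closed under multiplication by monomials.\<close>
  define J where "J = {f. \<forall>S. sat S \<longrightarrow> restr S f \<in> I}"
  have sat_shift: "sat {y. r + y \<in> S}" if "sat S" for r S
    using that simI_add[OF I] unfolding sat_def by blast
  have "r * f \<in> J" if f: "f \<in> J" for r f
  proof (induction r rule: pm_induct)
    case zero
    show ?case using I by (simp add: J_def is_ideal_def)
  next
    case (single r c)
    show ?case unfolding J_def
      using f sat_shift by (auto simp: J_def restr_single_mult intro!: ideal_mult[OF I])
  next
    case (add r s)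
    then show ?case by (auto simp: J_def distrib_right restr_add intro!: ideal_add[OF I])
  qed
  moreover have "0 \<in> J" using I by (simp add: J_def is_ideal_def)
  moreover have "f + g \<in> J" if "f \<in> J" "g \<in> J" for f g
    using that by (auto simp: J_def restr_add intro!: ideal_add[OF I])
  ultimately have "is_ideal J" by (simp add: is_ideal_def)
  moreover have "B \<subseteq> J"
  proof
    fix b assume b: "b \<in> B"
    then obtain p q c where bc: "b = mono p - Poly_Mapping.single q c" using B by blast
    have bI: "b \<in> I" using b BI by blast
    have "restr S b \<in> I" if "sat S" for S
    proof (cases "c = 0")
      \<comment> \<open>Here \<open>b\<close> is a monomial, so restricting it leaves
        \<open>b\<close> or 0.\<close>
      case True
      then show ?thesis using bI I by (auto simp: bc restr_single is_ideal_def)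
    next
      case False
      then have "simI I p q" using bI bc by (auto simp: simI_def)
      then have "p \<in> S \<longleftrightarrow> q \<in> S" using that by (simp add: sat_def)
      then show ?thesis using bI I by (auto simp: bc restr_diff restr_single is_ideal_def)
    qed
    then show "b \<in> J" by (simp add: J_def)
  qed
  ultimately have "I \<subseteq> J" unfolding B by (rule gen_ideal_least)
  moreover have "sat S" using S by (simp add: sat_def)
  ultimately show ?thesis using assms(2) by (auto simp: J_def)
qed

text \<open>For a sum, the product of the two multipliers works; primality keeps it outside
  \<open>pr\<close>. Properness gives the multiplier 1 for 0.\<close>

lemma is_ideal_loc_kernel:
  assumes "is_ideal I" "is_prime_ideal pr"
  shows "is_ideal (loc_kernel I pr)"
  unfolding is_ideal_def
proof (intro conjI ballI allI)
  have "1 \<notin> pr"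
  proof
    assume "1 \<in> pr"
    then have "r * 1 \<in> pr" for r using assms unfolding is_prime_ideal_def is_ideal_def by blast
    then show False using assms by (auto simp: is_prime_ideal_def)
  qed
  then show "0 \<in> loc_kernel I pr" using assms by (auto simp: loc_kernel_def is_ideal_def)
  fix a assume "a \<in> loc_kernel I pr"
  then obtain s where s: "s \<notin> pr" "s * a \<in> I" by (auto simp: loc_kernel_def)
  show "r * a \<in> loc_kernel I pr" for r
    using s ideal_mult[OF assms(1) s(2), of r] by (auto simp: loc_kernel_def ac_simps)
  fix b assume "b \<in> loc_kernel I pr"
  then obtain t where t: "t \<notin> pr" "t * b \<in> I" by (auto simp: loc_kernel_def)
  have "s * t * (a + b) = t * (s * a) + s * (t * b)" by (simp add: algebra_simps)
  also have "\<dots> \<in> I"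
    by (rule ideal_add[OF assms(1) ideal_mult[OF assms(1) s(2)] ideal_mult[OF assms(1) t(2)]])
  finally have "s * t * (a + b) \<in> I" .
  moreover have "s * t \<notin> pr" using s t assms by (auto simp: is_prime_ideal_def)
  ultimately show "a + b \<in> loc_kernel I pr" by (auto simp: loc_kernel_def)
qed

subsection \<open>Fractions\<close>

text \<open>Exactly the conditions under which the linear extension of \<open>\<chi>\<close> kills
  the generators of \<open>Irho P K \<rho>\<close> and of \<open>mP P\<close>.\<close>

definition equivariant :: "'q::comm_monoid_add set \<Rightarrow> ('q \<times> 'q) set set \<Rightarrow> (('q \<times> 'q) set \<Rightarrow> 'k::field)
     \<Rightarrow> (('q \<times> 'q) set \<Rightarrow> 'k) \<Rightarrow> bool" where
  "equivariant P K \<rho> \<chi> \<longleftrightarrow> (\<forall>X\<in>PP P. \<chi> X = 0) \<and>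
     (\<forall>g\<in>K. \<forall>v\<in>QP P. \<chi> (ladd P g v) = \<rho> g * \<chi> v)"

lemma lgen_superset: "S \<subseteq> lgen P S"
  by (auto simp: lgen_def)

lemma lgen_least: "lideal P J \<Longrightarrow> S \<subseteq> J \<Longrightarrow> lgen P S \<subseteq> J"
  by (auto simp: lgen_def)

lemma lsumI: "a \<in> J1 \<Longrightarrow> b \<in> J2 \<Longrightarrow> (\<lambda>X. a X + b X) \<in> lsum J1 J2"
  by (auto simp: lsum_def)

lemma lsumE:
  assumes "c \<in> lsum J1 J2"
  obtains a b where "a \<in> J1" "b \<in> J2" "c = (\<lambda>X. a X + b X)"
  using assms by (auto simp: lsum_def)

lemma lideal_0: "lideal P J \<Longrightarrow> (\<lambda>_. 0) \<in> J"
  by (simp add: lideal_def)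

lemma lideal_add: "lideal P J \<Longrightarrow> a \<in> J \<Longrightarrow> b \<in> J \<Longrightarrow> (\<lambda>X. a X + b X) \<in> J"
  by (simp add: lideal_def)

lemma lideal_lmul: "lideal P J \<Longrightarrow> r \<in> RP P \<Longrightarrow> a \<in> J \<Longrightarrow> lmul P r a \<in> J"
  by (simp add: lideal_def)

section \<open>The localized monoid\<close>

context
  fixes P :: "'q::comm_monoid_add set"
  assumes prime: "monoid_prime P"
begin

lemma zero_notin [simp]: "0 \<notin> P"
  using prime unfolding monoid_prime_def by (metis UNIV_eq_I add_0)

lemma add_notin_iff [simp]: "a + b \<notin> P \<longleftrightarrow> a \<notin> P \<and> b \<notin> P"
  using prime unfolding monoid_prime_def by (metis add.commute)

lemma add_in_iff [simp]: "a + b \<in> P \<longleftrightarrow> a \<in> P \<or> b \<in> P"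
  using add_notin_iff by blast

lemma equiv_locrel: "equiv (UNIV \<times> - P) (locrel P)"
proof (rule equivI)
  show "trans (locrel P)"
  proof (rule transI, clarsimp simp: locrel_def)
    fix a u b v c z w w'
    assume h: "w \<notin> P" "w' \<notin> P" "v \<notin> P" "a + v + w = b + u + w" "b + z + w' = c + v + w'"
    have "a + z + (v + w + w') = (a + v + w) + (z + w')" by (simp add: ac_simps)
    also have "\<dots> = (b + z + w') + (u + w)" unfolding h(4) by (simp add: ac_simps)
    also have "\<dots> = c + u + (v + w + w')" unfolding h(5) by (simp add: ac_simps)
    \<comment> \<open>Cancellation may fail in the monoid, so the middle denominator
      \<open>v\<close> goes into the witness.\<close>
    finally show "\<exists>w. w \<notin> P \<and> a + z + w = c + u + w"
      using h by (intro exI[of _ "v + w + w'"]) simp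
  qed
qed (auto simp: locrel_def refl_on_def sym_def intro: zero_notin dest: sym)

lemma lcls_eq_iff:
  assumes "u \<notin> P" "v \<notin> P"
  shows "lcls P a u = lcls P b v \<longleftrightarrow> (\<exists>w. w \<notin> P \<and> a + v + w = b + u + w)"
  using eq_equiv_class_iff[OF equiv_locrel, of "(a, u)" "(b, v)"] assms
  by (simp add: lcls_def locrel_def)

lemma QP_eq: "QP P = {lcls P a u | a u. u \<notin> P}"
  by (auto simp: QP_def lcls_def quotient_def)

lemma QP_lcls [simp]: "u \<notin> P \<Longrightarrow> lcls P a u \<in> QP P"
  by (auto simp: QP_eq)

lemma lcls_shift: "u \<notin> P \<Longrightarrow> w \<notin> P \<Longrightarrow> lcls P (a + w) (u + w) = lcls P a u"
  by (subst lcls_eq_iff) (auto simp: ac_simps intro!: exI[of _ 0])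

lemma lcls_self: "u \<notin> P \<Longrightarrow> lcls P u u = lzero P"
  using lcls_shift[of 0 u 0] by (simp add: lzero_def)

text \<open>\<open>ladd\<close> is a union over all representatives; each pair yields the same
  class, so the union collapses to it.\<close>

lemma ladd_lcls:
  assumes "u \<notin> P" "v \<notin> P"
  shows "ladd P (lcls P a u) (lcls P b v) = lcls P (a + b) (u + v)"
proof -
  have *: "lcls P (a' + b') (u' + v') = lcls P (a + b) (u + v)"
    if "(a', u') \<in> lcls P a u" "(b', v') \<in> lcls P b v" for a' u' b' v'
  proof -
    from that obtain w w' where w: "u' \<notin> P" "v' \<notin> P" "w \<notin> P" "w' \<notin> P"
      "a + u' + w = a' + u + w" "b + v' + w' = b' + v + w'"
      by (auto simp: lcls_def locrel_def)
    have "a' + b' + (u + v) + (w + w') = (a' + u + w) + (b' + v + w')" by (simp add: ac_simps)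
    also have "\<dots> = (a + u' + w) + (b + v' + w')" by (simp add: w)
    also have "\<dots> = a + b + (u' + v') + (w + w')" by (simp add: ac_simps)
    finally show ?thesis using w assms
      by (subst lcls_eq_iff) (auto intro!: exI[of _ "w + w'"])
  qed
  have "(a, u) \<in> lcls P a u" "(b, v) \<in> lcls P b v"
    using assms by (auto simp: lcls_def locrel_def intro: zero_notin)
  with * show ?thesis unfolding ladd_def by fast
qed

lemma lcls_in_PP_iff: "u \<notin> P \<Longrightarrow> lcls P a u \<in> PP P \<longleftrightarrow> a \<in> P"
proof
  assume u: "u \<notin> P" and "lcls P a u \<in> PP P"
  then obtain b v where b: "lcls P a u = lcls P b v" "b \<in> P" "v \<notin> P" by (auto simp: PP_def)
  then obtain w where w: "w \<notin> P" "a + v + w = b + u + w" using u lcls_eq_iff by blast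
  have "b + u + w \<in> P" using b by simp
  then have "a + v + w \<in> P" unfolding w(2) .
  then show "a \<in> P" using w(1) b(3) by simp
qed (auto simp: PP_def)

text \<open>An inverse \<open>b - v\<close> gives an equation whose side \<open>u + v + w\<close>
  avoids \<open>P\<close>, hence so does \<open>a\<close>. Conversely \<open>u - a\<close> is the
  inverse. Together with \<open>lcls_in_PP_iff\<close>, the non-units are precisely
  \<open>PP P\<close>.\<close>

lemma lcls_in_GP_iff:
  assumes u: "u \<notin> P" shows "lcls P a u \<in> GP P \<longleftrightarrow> a \<notin> P"
proof
  assume "lcls P a u \<in> GP P"
  then obtain b v where b: "v \<notin> P" "lcls P (a + b) (u + v) = lzero P"
    using u by (auto simp: GP_def QP_eq ladd_lcls)
  then obtain w where w: "w \<notin> P" "a + b + 0 + w = 0 + (u + v) + w"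
    using u lcls_eq_iff[of "u + v" 0] by (auto simp: lzero_def)
  have "0 + (u + v) + w \<notin> P" using u b w by simp
  then have "a + b + 0 + w \<notin> P" unfolding w(2) .
  then show "a \<notin> P" by simp
next
  assume a: "a \<notin> P"
  have "ladd P (lcls P a u) (lcls P u a) = lzero P"
    using a u lcls_self[of "a + u"] by (simp add: ladd_lcls add.commute)
  then show "lcls P a u \<in> GP P" using a u by (auto simp: GP_def)
qed

lemma GP_E:
  assumes "g \<in> GP P" obtains a u where "g = lcls P a u" "a \<notin> P" "u \<notin> P"
proof -
  have "g \<in> QP P" using assms by (simp add: GP_def)
  then obtain a u where "g = lcls P a u" "u \<notin> P" by (auto simp: QP_eq)
  with assms that show thesis using lcls_in_GP_iff by blast
qed

lemma QP_E:
  assumes "g \<in> QP P" obtains a u where "g = lcls P a u" "u \<notin> P"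
  using assms by (auto simp: QP_eq)

section \<open>Arithmetic and equality of fractions\<close>

lemma lfrac_mult:
  assumes "u \<notin> P" "v \<notin> P"
  shows "lmul P (lfrac P u f) (lfrac P v g) = lfrac P (u + v) (f * g)"
  by (rule ext) (simp add: lmul_eq_lpair lpair_lfrac ladd_lcls[OF assms], simp add: lfrac_def fpair_mult)

lemma lfrac_shift:
  assumes "u \<notin> P" "w \<notin> P"
  shows "lfrac P (u + w) (mono w * f) = lfrac P u f"
proof -
  have "lcls P (w + q) (u + w) = lcls P q u" for q
    using lcls_shift[OF assms, of q] by (simp add: add.commute)
  then show ?thesis by (simp add: lfrac_def fpair_mult)
qed

lemma lfrac_in_RP [simp]: "u \<notin> P \<Longrightarrow> lfrac P u f \<in> RP P"
  using supp_lfrac[of P u f] finite_subset[OF supp_lfrac[of P u f]] by (auto simp: RP_def)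

text \<open>A common denominator is built one point at a time: if the new point is
  \<open>a - v\<close> and the rest has denominator \<open>u\<close>, then \<open>u + v\<close>
  serves both. Computations then move to numerators in k[Q].\<close>

lemma RP_E:
  assumes "c \<in> RP P"
  obtains u f where "u \<notin> P" "c = lfrac P u f"
proof -
  have "\<exists>u f. u \<notin> P \<and> c = lfrac P u f" if "finite A" "A \<subseteq> QP P" "supp c \<subseteq> A" for A
    using that
  proof (induction A arbitrary: c rule: finite_induct)
    case empty
    then show ?case by (intro exI[of _ 0]) (auto simp: lfrac_0 supp_def)
  next
    case (insert X A)
    obtain a v where X: "X = lcls P a v" "v \<notin> P" using insert.prems by (auto simp: QP_eq)
    have "supp (c(X := 0)) \<subseteq> A" using insert.prems by (auto simp: supp_def)
    then obtain u f where u: "u \<notin> P" "c(X := 0) = lfrac P u f"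
      using insert by (metis insert_subset)
    have "lfrac P (u + v) (mono v * f + Poly_Mapping.single (a + u) (c X)) = c"
      using u X lcls_shift[of v u a] lfrac_shift[of u v f]
      by (auto simp: lfrac_add lfrac_single lmon_def fun_eq_iff add.commute[of v u]
          simp flip: u(2))
    then show ?case using u X by (metis add_notin_iff)
  qed
  then show thesis using that assms by (auto simp: RP_def)
qed

text \<open>Merging two terms of \<open>h\<close> whose exponents have the same class leaves the
  fraction unchanged and lowers the number of terms; a monomial outside \<open>P\<close> kills the
  difference.\<close>

lemma lfrac_eq_0D:
  assumes u: "u \<notin> P" and "lfrac P u h = (\<lambda>_. 0)"
  shows "\<exists>w. w \<notin> P \<and> mono w * h = 0"
  using assms(2)
proof (induction "card (Poly_Mapping.keys h)" arbitrary: h rule: less_induct)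
  case less
  show ?case
  proof (cases "h = 0")
    case True
    then show ?thesis by (intro exI[of _ 0]) simp
  next
    case False
    then obtain p where p: "p \<in> Poly_Mapping.keys h" by (metis keys_eq_empty ex_in_conv)
    \<comment> \<open>If \<open>p\<close> were alone in its class, the value of the fraction there
      would be the nonzero coefficient of \<open>h\<close> at \<open>p\<close>.\<close>
    have "\<exists>b. b \<in> Poly_Mapping.keys h \<and> b \<noteq> p \<and> lcls P b u = lcls P p u"
    proof (rule ccontr)
      assume "\<not> ?thesis"
      then have "lfrac P u h (lcls P p u)
          = (\<Sum>b\<in>Poly_Mapping.keys h. if b = p then Poly_Mapping.lookup h b else 0)"
        unfolding lfrac_def fpair_def by (intro sum.cong) auto
      then show False using less.prems p by (simp add: in_keys_iff)
    qed
    then obtain b where b: "b \<in> Poly_Mapping.keys h" "b \<noteq> p" "lcls P b u = lcls P p u" by blast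
    define c where "c = Poly_Mapping.lookup h b"
    define h' where "h' = h - Poly_Mapping.single b c + Poly_Mapping.single p c"
    have "card (Poly_Mapping.keys h') < card (Poly_Mapping.keys h)"
      unfolding h'_def c_def using b p by (intro card_keys_merge_less) auto
    moreover have "lfrac P u h' = (\<lambda>_. 0)"
      using less.prems b by (simp add: h'_def lfrac_add lfrac_diff lfrac_single)
    ultimately obtain w where w: "w \<notin> P" "mono w * h' = 0" using less.hyps by blast
    obtain x where x: "x \<notin> P" "b + u + x = p + u + x" using b u lcls_eq_iff by blast
    \<comment> \<open>\<open>h\<close> is \<open>h'\<close> plus a binomial in \<open>b\<close> and
      \<open>p\<close>; the factor \<open>w\<close> kills the former and \<open>u + x\<close> the
      latter.\<close>
    have "mono (w + u + x) * h = mono (u + x) * (mono w * h')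
        + mono w * (mono (u + x) * (Poly_Mapping.single b c - Poly_Mapping.single p c))"
      by (simp add: h'_def algebra_simps mult_single)
    also have "mono (u + x) * (Poly_Mapping.single b c - Poly_Mapping.single p c) = 0"
      using x by (simp add: algebra_simps mult_single)
    finally have "mono (w + u + x) * h = 0" using w by simp
    then show ?thesis using w x u by (metis add_notin_iff)
  qed
qed

lemma lfrac_eqD:
  assumes "u \<notin> P" "v \<notin> P" "lfrac P u f = lfrac P v g"
  shows "\<exists>w. w \<notin> P \<and> mono (w + v) * f = mono (w + u) * g"
proof -
  have "lfrac P (u + v) (mono v * f - mono u * g) = (\<lambda>_. 0)"
    using assms lfrac_shift[of u v f] lfrac_shift[of v u g] by (simp add: lfrac_diff add.commute)
  then obtain w where "w \<notin> P" "mono w * (mono v * f - mono u * g) = 0"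
    using lfrac_eq_0D[of "u + v"] assms by auto
  moreover have "mono w * (mono v * f - mono u * g) = mono (w + v) * f - mono (w + u) * g"
    by (simp add: right_diff_distrib mult_single flip: mult.assoc)
  ultimately show ?thesis by auto
qed

subsection \<open>Equivariant functionals\<close>

lemma lfrac_add_common:
  assumes "u \<notin> P" "v \<notin> P"
  shows "(\<lambda>X. lfrac P u f X + lfrac P v g X) = lfrac P (u + v) (mono v * f + mono u * g)"
  using assms lfrac_shift[of u v f] lfrac_shift[of v u g]
  by (simp add: lfrac_add add.commute[of v u])

text \<open>Terms may cancel and change the support, so the sum is taken over a common denominator
  and additivity is read off from \<open>fpair_add\<close>.\<close>

lemma lpair_add:
  assumes "c \<in> RP P" "d \<in> RP P"
  shows "lpair (\<lambda>X. c X + d X) \<chi> = lpair c \<chi> + lpair d \<chi>"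
proof -
  obtain u f v g where c: "u \<notin> P" "c = lfrac P u f" and d: "v \<notin> P" "d = lfrac P v g"
    by (rule RP_E[OF assms(1)]) (rule RP_E[OF assms(2)], blast)
  have "lpair (\<lambda>X. c X + d X) \<chi>
      = lpair (lfrac P (u + v) (mono v * f)) \<chi> + lpair (lfrac P (u + v) (mono u * g)) \<chi>"
    unfolding c d lfrac_add_common[OF c(1) d(1)] by (simp only: lpair_lfrac fpair_add)
  then show ?thesis
    using c d lfrac_shift[of u v f] lfrac_shift[of v u g] by (simp add: add.commute[of v u])
qed

section \<open>Ideals of the localized algebra\<close>

lemma lideal_fractions:
  fixes J :: "('q \<Rightarrow>\<^sub>0 'k::field) set"
  assumes "is_ideal J"
  shows "lideal P {lfrac P u f | u f. u \<notin> P \<and> f \<in> J}"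
  unfolding lideal_def
proof (intro conjI ballI)
  show "(\<lambda>_. 0) \<in> {lfrac P u f |u f. u \<notin> P \<and> f \<in> J}"
    using assms by (auto simp: is_ideal_def intro!: exI[of _ 0] lfrac_0[symmetric])
next
  fix a b assume "a \<in> {lfrac P u f |u f. u \<notin> P \<and> f \<in> J}" "b \<in> {lfrac P u f |u f. u \<notin> P \<and> f \<in> J}"
  then obtain u f v g where a: "a = lfrac P u f" "u \<notin> P" "f \<in> J" and b: "b = lfrac P v g" "v \<notin> P" "g \<in> J"
    by blast
  have "mono v * f + mono u * g \<in> J" using assms a b by (simp add: is_ideal_def)
  then show "(\<lambda>X. a X + b X) \<in> {lfrac P u f |u f. u \<notin> P \<and> f \<in> J}"
    unfolding a b lfrac_add_common[OF a(2) b(2)] using a b by (auto intro!: exI[of _ "u + v"])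
next
  fix r a :: "('q \<times> 'q) set \<Rightarrow> 'k"
  assume "r \<in> RP P" "a \<in> {lfrac P u f |u f. u \<notin> P \<and> f \<in> J}"
  then obtain v g where a: "a = lfrac P v g" "v \<notin> P" "g \<in> J" by blast
  obtain u f where r: "r = lfrac P u f" "u \<notin> P" using RP_E[OF \<open>r \<in> RP P\<close>] .
  have "f * g \<in> J" using assms a by (simp add: is_ideal_def)
  then show "lmul P r a \<in> {lfrac P u f |u f. u \<notin> P \<and> f \<in> J}"
    unfolding r a lfrac_mult[OF r(2) a(2)] using r a by (auto intro!: exI[of _ "u + v"])
qed auto

lemma lideal_RP: "lideal P (RP P :: (_ \<Rightarrow> 'k::field) set)"
proof -
  have "is_ideal (UNIV :: ('q \<Rightarrow>\<^sub>0 'k) set)" by (simp add: is_ideal_def)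
  note lideal_fractions[OF this]
  also have "{lfrac P u f | u (f :: 'q \<Rightarrow>\<^sub>0 'k). u \<notin> P \<and> f \<in> UNIV} = RP P"
  proof (intro equalityI subsetI)
    fix c :: "('q \<times> 'q) set \<Rightarrow> 'k"
    assume "c \<in> RP P"
    then show "c \<in> {lfrac P u f | u f. u \<notin> P \<and> f \<in> UNIV}" by (rule RP_E) blast
  qed auto
  finally show ?thesis .
qed

text \<open>When \<open>S\<close> lies in \<open>RP P\<close>, that set is one of the ideals
  intersected, which keeps the intersection inside it.\<close>

lemma lideal_lgen:
  assumes "S \<subseteq> RP P" shows "lideal P (lgen P S)"
proof -
  have "lgen P S \<subseteq> RP P" using lgen_least[OF lideal_RP assms] .
  then show ?thesis unfolding lideal_def lgen_def by blast
qed

lemma lfrac_in_IP: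
  assumes "f \<in> I" "v \<notin> P"
  shows "lfrac P v f \<in> IP P I"
proof -
  have "lideal P (IP P I)" unfolding IP_def by (rule lideal_lgen) (auto simp: lemb_eq_lfrac)
  moreover have "lemb P f \<in> IP P I" using assms lgen_superset unfolding IP_def by blast
  ultimately have "lmul P (lfrac P v 1) (lemb P f) \<in> IP P I"
    using assms by (simp add: lideal_def)
  then show ?thesis using assms by (simp add: lemb_eq_lfrac lfrac_mult)
qed

text \<open>The fractions with numerator in \<open>I\<close> already form an ideal containing the
  generators; conversely each is an element of \<open>I\<close> times a fraction with numerator
  1.\<close>

lemma IP_eq:
  assumes "is_ideal I"
  shows "IP P I = {lfrac P u f | u f. u \<notin> P \<and> f \<in> I}"
proof
  show "IP P I \<subseteq> {lfrac P u f | u f. u \<notin> P \<and> f \<in> I}"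
    unfolding IP_def
  proof (rule lgen_least[OF lideal_fractions[OF assms]], rule image_subsetI)
    show "lemb P f \<in> {lfrac P u f | u f. u \<notin> P \<and> f \<in> I}" if "f \<in> I" for f
      using that zero_notin unfolding lemb_eq_lfrac by blast
  qed
qed (auto intro: lfrac_in_IP)

lemma lideal_IP: "is_ideal I \<Longrightarrow> lideal P (IP P I)"
  by (simp add: IP_eq lideal_fractions)

lemma PP_lmon_subset_RP: "lmon ` PP P \<subseteq> RP P"
  by (auto simp: PP_def lmon_eq_lfrac)

lemma lideal_mP: "lideal P (mP P)"
  unfolding mP_def by (rule lideal_lgen[OF PP_lmon_subset_RP])

text \<open>Over the common denominator \<open>u + v\<close>, the element \<open>b - v\<close>
  acquires the numerator \<open>u + b\<close>.\<close>

lemma Irho_generator_eq_lfrac: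
  assumes "u \<notin> P" "v \<notin> P"
  shows "(\<lambda>Y. lmon (ladd P (lcls P a u) (lcls P b v)) Y - c * lmon (lcls P b v) Y)
       = lfrac P (u + v) (mono (a + b) - Poly_Mapping.single (u + b) c)"
  using assms lcls_shift[of v u b]
  by (simp add: ladd_lcls lfrac_diff lfrac_single add.commute)

lemma Irho_generators_subset_RP:
  assumes "K \<subseteq> GP P"
  shows "{(\<lambda>Y. lmon (ladd P g v) Y - \<rho> g * lmon v Y) | g v. g \<in> K \<and> v \<in> QP P} \<subseteq> RP P"
proof clarify
  fix g v assume "g \<in> K" "v \<in> QP P"
  then have "g \<in> GP P" using assms by blast
  then obtain a u where g: "g = lcls P a u" "u \<notin> P" using GP_E by blast
  obtain b w where v: "v = lcls P b w" "w \<notin> P" using \<open>v \<in> QP P\<close> QP_E by blast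
  show "(\<lambda>Y. lmon (ladd P g v) Y - \<rho> g * lmon v Y) \<in> RP P"
    unfolding g v Irho_generator_eq_lfrac[OF g(2) v(2)] using g v by simp
qed

lemma lideal_Irho: "K \<subseteq> GP P \<Longrightarrow> lideal P (Irho P K \<rho>)"
  unfolding Irho_def by (rule lideal_lgen[OF Irho_generators_subset_RP])

text \<open>Translation by \<open>X\<close> commutes with adding \<open>g\<close> and maps
  \<open>PP P\<close> into itself.\<close>

lemma equivariant_translate:
  assumes "equivariant P K \<rho> \<chi>" "K \<subseteq> GP P" "X \<in> QP P"
  shows "equivariant P K \<rho> (\<lambda>Y. \<chi> (ladd P X Y))"
  unfolding equivariant_def
proof (intro conjI ballI)
  obtain a u where X: "X = lcls P a u" "u \<notin> P" using assms QP_E by blast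
  show "\<chi> (ladd P X Y) = 0" if Y: "Y \<in> PP P" for Y
  proof -
    obtain b v where "Y = lcls P b v" "b \<in> P" "v \<notin> P" using Y by (auto simp: PP_def)
    then have "ladd P X Y \<in> PP P" using X by (simp add: ladd_lcls lcls_in_PP_iff)
    then show ?thesis using assms by (simp add: equivariant_def)
  qed
  show "\<chi> (ladd P X (ladd P g v)) = \<rho> g * \<chi> (ladd P X v)" if gK: "g \<in> K" and vQ: "v \<in> QP P" for g v
  proof -
    obtain b w where g: "g = lcls P b w" "w \<notin> P" using gK assms(2) GP_E by blast
    obtain c z where v: "v = lcls P c z" "z \<notin> P" using vQ QP_E by blast
    have "ladd P X (ladd P g v) = ladd P g (ladd P X v)"
      using X g v by (simp add: ladd_lcls ac_simps)
    moreover have "ladd P X v \<in> QP P" using X v by (simp add: ladd_lcls)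
    ultimately show ?thesis using assms(1) gK by (simp add: equivariant_def)
  qed
qed

text \<open>The elements killed by every equivariant functional form an ideal that contains both
  sets of generators.\<close>

lemma lpair_equivariant_eq_0:
  fixes \<rho> :: "('q \<times> 'q) set \<Rightarrow> 'k::field"
  assumes "K \<subseteq> GP P" "c \<in> lsum (Irho P K \<rho>) (mP P)" "equivariant P K \<rho> \<chi>"
  shows "lpair c \<chi> = 0"
proof -
  \<comment> \<open>All functionals are tested at once, since pairing a product with one of them
    yields a combination of pairings with its translates.\<close>
  define V where "V = {c \<in> RP P. \<forall>\<chi>. equivariant P K \<rho> \<chi> \<longrightarrow> lpair c \<chi> = 0}"
  have V: "lideal P V"
    unfolding lideal_def
  proof (intro conjI ballI)
    show "V \<subseteq> RP P" by (auto simp: V_def)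
    show "(\<lambda>_. 0) \<in> V" using lideal_RP[where 'k = 'k] by (simp add: V_def lpair_def supp_def lideal_def)
    show "(\<lambda>X. a X + b X) \<in> V" if "a \<in> V" "b \<in> V" for a b
      using that lideal_RP[where 'k = 'k] by (simp add: V_def lpair_add lideal_def)
    show "lmul P r a \<in> V" if r: "r \<in> RP P" and a: "a \<in> V" for r a
    proof -
      have "a \<in> RP P" using a by (simp add: V_def)
      then obtain u f v g where rf: "u \<notin> P" "r = lfrac P u f" and ag: "v \<notin> P" "a = lfrac P v g"
        by (rule RP_E) (rule RP_E[OF r], blast)
      have "lpair (lmul P r a) \<chi> = 0" if "equivariant P K \<rho> \<chi>" for \<chi>
      proof -
        have "fpair g (\<lambda>q. \<chi> (lcls P (p + q) (u + v))) = 0" for p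
        proof -
          have "equivariant P K \<rho> (\<lambda>Y. \<chi> (ladd P (lcls P p u) Y))"
            using that assms(1) rf by (intro equivariant_translate) auto
          then have "lpair a (\<lambda>Y. \<chi> (ladd P (lcls P p u) Y)) = 0" using a by (simp add: V_def)
          then show ?thesis using rf ag by (simp add: lpair_lfrac ladd_lcls)
        qed
        then show ?thesis using rf ag by (simp add: lfrac_mult lpair_lfrac fpair_mult)
      qed
      moreover have "lmul P r a \<in> RP P" using rf ag by (simp add: lfrac_mult)
      ultimately show ?thesis by (simp add: V_def)
    qed
  qed
  have "mP P \<subseteq> V"
    unfolding mP_def
  proof (rule lgen_least[OF V], rule image_subsetI)
    fix X assume X: "X \<in> PP P"
    then obtain a u where "X = lcls P a u" "u \<notin> P" by (auto simp: PP_def)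
    then show "lmon X \<in> V"
      using X by (auto simp: V_def lmon_eq_lfrac lpair_lfrac equivariant_def)
  qed
  moreover have "(\<lambda>Y. lmon (ladd P g v) Y - \<rho> g * lmon v Y) \<in> V"
    if gK: "g \<in> K" and vQ: "v \<in> QP P" for g v
  proof -
    have "g \<in> GP P" using assms(1) gK by blast
    then obtain a u where g: "g = lcls P a u" "u \<notin> P" using GP_E by blast
    obtain b w where v: "v = lcls P b w" "w \<notin> P" using vQ QP_E by blast
    have "lpair (lfrac P (u + w) (mono (a + b) - Poly_Mapping.single (u + b) (\<rho> g))) \<chi> = 0"
      if eqv: "equivariant P K \<rho> \<chi>" for \<chi>
    proof -
      have "\<chi> (ladd P g v) = \<rho> g * \<chi> v"
        using eqv gK vQ by (simp add: equivariant_def)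
      then have "\<chi> (lcls P (a + b) (u + w)) = \<rho> g * \<chi> (lcls P b w)"
        using g v by (simp add: ladd_lcls)
      moreover have "lcls P (u + b) (u + w) = lcls P b w"
        using g v lcls_shift[of w u b] by (simp add: add.commute)
      ultimately show ?thesis by (simp add: lpair_lfrac fpair_diff)
    qed
    then show ?thesis
      using g(2) v(2) unfolding g(1) v(1) Irho_generator_eq_lfrac[OF g(2) v(2)]
      by (simp add: V_def)
  qed
  then have "Irho P K \<rho> \<subseteq> V"
    unfolding Irho_def by (intro lgen_least[OF V]) blast
  ultimately have "c \<in> V" using assms(2) lideal_add[OF V] by (auto elim!: lsumE)
  then show ?thesis using assms(3) by (simp add: V_def)
qed

lemma character_lzero:
  assumes "is_character P K \<rho>" shows "\<rho> (lzero P) = 1"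
proof -
  have "ladd P (lzero P) (lzero P) = lzero P" by (simp add: lzero_def ladd_lcls)
  then have "\<rho> (lzero P) * \<rho> (lzero P) = \<rho> (lzero P)" "\<rho> (lzero P) \<noteq> 0"
    using assms unfolding is_character_def subgroup_GP_def by metis+
  then show ?thesis by simp
qed

text \<open>Since \<open>K\<close> is a group, adding \<open>g\<close> from \<open>K\<close> moves
  no element into or out of \<open>K\<close>; and \<open>K\<close>, consisting of units, misses
  \<open>PP P\<close>.\<close>

lemma character_extension_equivariant:
  assumes "is_character P K \<rho>"
  shows "equivariant P K \<rho> (\<lambda>X. if X \<in> K then \<rho> X else 0)"
  unfolding equivariant_def
proof (intro conjI ballI)
  have K: "K \<subseteq> GP P" and add: "\<And>g h. g \<in> K \<Longrightarrow> h \<in> K \<Longrightarrow> ladd P g h \<in> K"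
    and inv: "\<And>g. g \<in> K \<Longrightarrow> \<exists>h\<in>K. ladd P g h = lzero P"
    and mul: "\<And>g h. g \<in> K \<Longrightarrow> h \<in> K \<Longrightarrow> \<rho> (ladd P g h) = \<rho> g * \<rho> h"
    using assms unfolding is_character_def subgroup_GP_def by blast+
  show "(if X \<in> K then \<rho> X else 0) = 0" if "X \<in> PP P" for X
  proof -
    have "X \<notin> GP P" using that by (auto simp: PP_def lcls_in_GP_iff)
    then show ?thesis using K by auto
  qed
  show "(if ladd P g v \<in> K then \<rho> (ladd P g v) else 0) = \<rho> g * (if v \<in> K then \<rho> v else 0)"
    if g: "g \<in> K" and v: "v \<in> QP P" for g v
  proof -
    have "v \<in> K" if gv: "ladd P g v \<in> K"
    proof -
      obtain h where h: "h \<in> K" "ladd P g h = lzero P" using inv g by blast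
      have "g \<in> GP P" "h \<in> GP P" using g h K by auto
      then obtain a u b w where "g = lcls P a u" "u \<notin> P" "h = lcls P b w" "w \<notin> P"
        by (elim GP_E) blast
      moreover obtain c z where "v = lcls P c z" "z \<notin> P" using v QP_E by blast
      ultimately have eqs: "g = lcls P a u" "u \<notin> P" "h = lcls P b w" "w \<notin> P"
        "v = lcls P c z" "z \<notin> P" .
      have "ladd P h (ladd P g v) = ladd P (ladd P g h) v"
        using eqs by (simp add: ladd_lcls ac_simps)
      also have "\<dots> = v" unfolding h(2) using eqs by (simp add: lzero_def ladd_lcls)
      finally show ?thesis using add[OF h(1) gv] by simp
    qed
    then show ?thesis using add mul g by auto
  qed
qed

text \<open>Pair the binomial with the extension of \<open>\<sigma>\<close> by zero, translated by
  \<open>-u\<close>: the result is its value at \<open>a - u\<close> minus \<open>c\<close>. As this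
  vanishes and \<open>c\<close> is nonzero, \<open>a - u\<close> cannot lie outside
  \<open>L\<close>.\<close>

lemma IrhoP_binomialD:
  assumes "is_character P L \<sigma>" "mono a - Poly_Mapping.single u c \<in> IrhoP P L \<sigma>"
    "u \<notin> P" "c \<noteq> 0"
  shows "lcls P a u \<in> L \<and> \<sigma> (lcls P a u) = c"
proof -
  let ?\<chi> = "\<lambda>X. if X \<in> L then \<sigma> X else 0"
  have L: "L \<subseteq> GP P" "lzero P \<in> L" using assms(1) by (auto simp: is_character_def subgroup_GP_def)
  have "equivariant P L \<sigma> (\<lambda>Y. ?\<chi> (ladd P (lcls P 0 u) Y))"
    using assms L
    by (intro equivariant_translate[OF character_extension_equivariant]) auto
  then have "lpair (lemb P (mono a - Poly_Mapping.single u c))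
      (\<lambda>Y. ?\<chi> (ladd P (lcls P 0 u) Y)) = 0"
    using assms(2) L by (intro lpair_equivariant_eq_0) (auto simp: IrhoP_def)
  moreover have "ladd P (lcls P 0 u) (lcls P b 0) = lcls P b u" for b
    using assms by (simp add: ladd_lcls)
  ultimately have "?\<chi> (lcls P a u) = c"
    using assms L character_lzero[OF assms(1)]
    by (simp add: lemb_eq_lfrac lpair_lfrac fpair_diff lcls_self cong: if_cong)
  then show ?thesis using assms(4) by (auto split: if_splits)
qed

text \<open>The extension of \<open>\<sigma>\<close> by zero, translated by \<open>-w\<close>, takes
  the value 1 on this monomial.\<close>

lemma mono_notin_IrhoP:
  assumes "is_character P L \<sigma>" "w \<notin> P"
  shows "mono w \<notin> IrhoP P L \<sigma>"
proof
  let ?\<chi> = "\<lambda>X. if X \<in> L then \<sigma> X else 0"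
  have L: "L \<subseteq> GP P" "lzero P \<in> L" using assms(1) by (auto simp: is_character_def subgroup_GP_def)
  have "equivariant P L \<sigma> (\<lambda>Y. ?\<chi> (ladd P (lcls P 0 w) Y))"
    using assms L
    by (intro equivariant_translate[OF character_extension_equivariant]) auto
  moreover assume "mono w \<in> IrhoP P L \<sigma>"
  ultimately have "lpair (lemb P (mono w)) (\<lambda>Y. ?\<chi> (ladd P (lcls P 0 w) Y)) = 0"
    using L by (intro lpair_equivariant_eq_0) (auto simp: IrhoP_def)
  then show False
    using assms L character_lzero[OF assms(1)]
    by (simp add: lemb_eq_lfrac lpair_lfrac ladd_lcls lcls_self)
qed

lemma mP_subset_lsum:
  fixes \<rho> :: "('q \<times> 'q) set \<Rightarrow> 'b::field"
  assumes "K \<subseteq> GP P" shows "mP P \<subseteq> lsum (Irho P K \<rho>) (mP P)"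
proof
  fix m :: "('q \<times> 'q) set \<Rightarrow> 'b" assume "m \<in> mP P"
  moreover have "(\<lambda>_. 0) \<in> Irho P K \<rho>" by (rule lideal_0[OF lideal_Irho[OF assms]])
  ultimately have "(\<lambda>X. 0 + m X) \<in> lsum (Irho P K \<rho>) (mP P)" by (intro lsumI)
  then show "m \<in> lsum (Irho P K \<rho>) (mP P)" by simp
qed

lemma Irho_subset_lsum:
  fixes \<rho> :: "('q \<times> 'q) set \<Rightarrow> 'b::field"
  shows "Irho P K \<rho> \<subseteq> lsum (Irho P K \<rho>) (mP P)"
proof
  fix i :: "('q \<times> 'q) set \<Rightarrow> 'b" assume "i \<in> Irho P K \<rho>"
  moreover have "(\<lambda>_. 0) \<in> mP P" by (rule lideal_0[OF lideal_mP])
  ultimately have "(\<lambda>X. i X + 0) \<in> lsum (Irho P K \<rho>) (mP P)" by (intro lsumI)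
  then show "i \<in> lsum (Irho P K \<rho>) (mP P)" by simp
qed

subsection \<open>The character at a monomial outside the kernel\<close>

text \<open>Uniqueness for the description in \<open>rhoq\<close>: the binomial of \<open>g\<close>
  for \<open>\<rho>\<close> also lies in the ideal of \<open>\<rho>'\<close>, and pairing it with
  the extension of \<open>\<rho>'\<close> by zero gives
  \<open>\<rho>' g - \<rho> g = 0\<close>.\<close>

lemma character_eq_if_lsum_Irho_eq:
  assumes "is_character P K \<rho>" "is_character P K \<rho>'"
    and "lsum (Irho P K \<rho>) (mP P) = lsum (Irho P K \<rho>') (mP P)" "g \<in> K"
  shows "\<rho> g = \<rho>' g"
proof -
  have K: "K \<subseteq> GP P" "lzero P \<in> K" using assms(1) by (auto simp: is_character_def subgroup_GP_def)
  then have "g \<in> GP P" using assms(4) by blast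
  then obtain a u where g: "g = lcls P a u" "u \<notin> P" using GP_E by blast
  have "lzero P \<in> QP P" by (simp add: lzero_def)
  then have "(\<lambda>Y. lmon (ladd P g (lzero P)) Y - \<rho> g * lmon (lzero P) Y) \<in> Irho P K \<rho>"
    unfolding Irho_def by (intro subsetD[OF lgen_superset]) (use assms(4) in blast)
  moreover have "(\<lambda>Y. lmon (ladd P g (lzero P)) Y - \<rho> g * lmon (lzero P) Y)
      = lfrac P u (mono a - Poly_Mapping.single u (\<rho> g))"
    using Irho_generator_eq_lfrac[OF g(2) zero_notin, of a 0 "\<rho> g"] by (simp add: g(1) lzero_def)
  ultimately have "lfrac P u (mono a - Poly_Mapping.single u (\<rho> g)) \<in> lsum (Irho P K \<rho>') (mP P)"
    using Irho_subset_lsum[of K \<rho>] assms(3) by auto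
  then have "lpair (lfrac P u (mono a - Poly_Mapping.single u (\<rho> g)))
      (\<lambda>X. if X \<in> K then \<rho>' X else 0) = 0"
    by (rule lpair_equivariant_eq_0[OF K(1) _ character_extension_equivariant[OF assms(2)]])
  then show ?thesis
    using K g assms(4) character_lzero[OF assms(2)] by (simp add: lpair_lfrac fpair_diff lcls_self)
qed

text \<open>The ring laws for \<open>lmul\<close> on \<open>RP P\<close> are derived by writing all
  elements as fractions.\<close>

lemma lideal_lcolon:
  assumes "lideal P J" shows "lideal P (lcolon P J q)"
proof -
  have add: "lmul P (\<lambda>X. a X + b X) m = (\<lambda>X. lmul P a m X + lmul P b m X)"
    and mul: "lmul P (lmul P r a) m = lmul P r (lmul P a m)"
    and closed: "(\<lambda>X. a X + b X) \<in> RP P" "lmul P r a \<in> RP P" "(\<lambda>_. 0) \<in> RP P"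
    and zero: "lmul P (\<lambda>_. 0) m = (\<lambda>_. 0)"
    if RP: "a \<in> RP P" "b \<in> RP P" "r \<in> RP P" "m \<in> RP P" for a b r m :: "('q \<times> 'q) set \<Rightarrow> 'a"
  proof -
    obtain u f where a: "u \<notin> P" "a = lfrac P u f" using RP_E[OF RP(1)] .
    obtain v g where b: "v \<notin> P" "b = lfrac P v g" using RP_E[OF RP(2)] .
    obtain w h where r: "w \<notin> P" "r = lfrac P w h" using RP_E[OF RP(3)] .
    obtain x l where m: "x \<notin> P" "m = lfrac P x l" using RP_E[OF RP(4)] .
    show "lmul P (lmul P r a) m = lmul P r (lmul P a m)"
      using a r m by (simp add: lfrac_mult ac_simps)
    show "lmul P (\<lambda>_. 0) m = (\<lambda>_. 0)"
      by (simp add: lmul_def supp_def)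
    have "(\<lambda>X. lmul P a m X + lmul P b m X)
        = lfrac P ((u + x) + (v + x)) (mono (v + x) * (f * l) + mono (u + x) * (g * l))"
      using a b m lfrac_add_common[of "u + x" "v + x"] by (simp add: lfrac_mult)
    also have "mono (v + x) * (f * l) + mono (u + x) * (g * l)
        = mono x * ((mono v * f + mono u * g) * l)"
      by (simp add: algebra_simps mult_single flip: mult.assoc)
    \<comment> \<open>The summand \<open>x\<close> occurs in both denominators, so one factor
      \<open>mono x\<close> cancels.\<close>
    also have "lfrac P ((u + x) + (v + x)) \<dots> = lfrac P ((u + v) + x) ((mono v * f + mono u * g) * l)"
      using lfrac_shift[of "(u + v) + x" x "(mono v * f + mono u * g) * l"] a b m
      by (simp add: add.assoc add.left_commute[of x v])
    also have "\<dots> = lmul P (\<lambda>X. a X + b X) m"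
      unfolding a b m lfrac_add_common[OF a(1) b(1)] using a b m by (simp add: lfrac_mult)
    finally show "lmul P (\<lambda>X. a X + b X) m = (\<lambda>X. lmul P a m X + lmul P b m X)" by simp
    show "(\<lambda>X. a X + b X) \<in> RP P" "lmul P r a \<in> RP P" "(\<lambda>_. 0) \<in> RP P"
      using RP lideal_RP by (auto intro: lideal_0 lideal_add lideal_lmul)
  qed
  have m: "lmon (lcls P q 0) \<in> RP P" by (simp add: lmon_eq_lfrac)
  have J: "J \<subseteq> RP P" using assms by (simp add: lideal_def)
  show ?thesis
    unfolding lideal_def lcolon_def
    using m add[OF _ _ m m] mul[OF _ m _ m] closed[OF _ _ m m] closed[OF _ m _ m] zero[OF m m m m]
      lideal_0[OF assms] lideal_add[OF assms] lideal_lmul[OF assms]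
    by auto
qed

lemma lfrac_in_mP:
  assumes "u \<notin> P" "Poly_Mapping.keys s \<subseteq> P"
  shows "lfrac P u s \<in> mP P"
proof -
  have single: "lfrac P u (Poly_Mapping.single p c) \<in> mP P" if "p \<in> P" for p and c :: 'a
  proof -
    have "lmon (lcls P p u) \<in> mP P" unfolding mP_def
      using that assms by (intro subsetD[OF lgen_superset]) (simp add: lcls_in_PP_iff)
    then have "lmul P (lfrac P 0 (Poly_Mapping.single 0 c)) (lmon (lcls P p u)) \<in> mP P"
      by (intro lideal_lmul[OF lideal_mP]) auto
    then show ?thesis using assms by (simp add: lmon_eq_lfrac lfrac_mult mult_single)
  qed
  have "lfrac P u (\<Sum>q\<in>A. Poly_Mapping.single q (c q)) \<in> mP P" if "finite A" "A \<subseteq> P" for A and c :: "'q \<Rightarrow> 'a"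
    using that
  proof (induction A rule: finite_induct)
    case empty
    show ?case using lideal_0[OF lideal_mP] by (simp add: lfrac_0)
  next
    case (insert x A)
    then show ?case using single by (auto simp: lfrac_add intro!: lideal_add[OF lideal_mP])
  qed
  from this[of "Poly_Mapping.keys s" "Poly_Mapping.lookup s"] assms(2) show ?thesis
    by (simp flip: pm_sum_singles)
qed

section \<open>The localized quotient monoid\<close>

lemma equiv_barrel:
  assumes I: "is_ideal I" shows "equiv (UNIV \<times> - P) (barrel I P)"
proof (rule equivI)
  show "trans (barrel I P)"
  proof (rule transI, clarsimp simp: barrel_def)
    fix a u b v c z w w'
    assume h: "w \<notin> P" "w' \<notin> P" "v \<notin> P" "simI I (a + v + w) (b + u + w)" "simI I (b + z + w') (c + v + w')"
    have "simI I (a + z + (v + w + w')) (b + z + u + w + w')"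
      using simI_add[OF I h(4), of "z + w'"] by (simp add: ac_simps)
    moreover have "simI I (b + z + u + w + w') (c + u + (v + w + w'))"
      using simI_add[OF I h(5), of "u + w"] by (simp add: ac_simps)
    ultimately show "\<exists>w. w \<notin> P \<and> simI I (a + z + w) (c + u + w)"
      using h simI_trans[OF I] by (intro exI[of _ "v + w + w'"]) auto
  qed
  show "sym (barrel I P)" using simI_sym[OF I] by (fastforce simp: barrel_def sym_def)
  show "refl_on (UNIV \<times> - P) (barrel I P)"
    using simI_refl[OF I] zero_notin by (auto simp: barrel_def refl_on_def)
  show "barrel I P \<subseteq> (UNIV \<times> - P) \<times> (UNIV \<times> - P)" by (auto simp: barrel_def)
qed

text \<open>\<open>qbar\<close> takes the image of a whole \<open>locrel\<close> class. As
  \<open>locrel P\<close> is contained in the transitive relation \<open>barrel I P\<close>, this is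
  the \<open>barrel\<close> class of any one representative.\<close>

lemma qbar_lcls_eq_iff:
  assumes I: "is_ideal I" and "u \<notin> P" "v \<notin> P"
  shows "qbar I P (lcls P a u) = qbar I P (lcls P b v)
    \<longleftrightarrow> (\<exists>w. w \<notin> P \<and> simI I (a + v + w) (b + u + w))"
proof -
  have "qbar I P (lcls P a u) = barrel I P `` {(a, u)}" if "u \<notin> P" for a u
  proof -
    have "locrel P \<subseteq> barrel I P" using simI_refl[OF I] by (fastforce simp: locrel_def barrel_def)
    moreover have "(a, u) \<in> lcls P a u"
      using that zero_notin by (auto simp: lcls_def locrel_def)
    moreover have "trans (barrel I P)" using equiv_barrel[OF I] by (simp add: equiv_def)
    ultimately show ?thesis unfolding qbar_def lcls_def by (blast dest: transD)
  qed
  then show ?thesis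
    using assms eq_equiv_class_iff[OF equiv_barrel[OF I], of "(a, u)" "(b, v)"]
    by (simp add: barrel_def)
qed

section \<open>Monomials multiplied into \<open>I\<close> from outside the prime ideal\<close>

context
  fixes I :: "('q \<Rightarrow>\<^sub>0 'k::field) set" and L :: "('q \<times> 'q) set set"
    and \<sigma> :: "('q \<times> 'q) set \<Rightarrow> 'k"
  assumes I: "is_ideal I" and binomial: "binomial_ideal I"
    and character: "is_character P L \<sigma>" and prime_ideal: "is_prime_ideal (IrhoP P L \<sigma>)"
begin

lemma L_subset_GP: "L \<subseteq> GP P"
  using character by (auto simp: is_character_def subgroup_GP_def)

lemma is_ideal_IrhoP: "is_ideal (IrhoP P L \<sigma>)"
  using prime_ideal by (simp add: is_prime_ideal_def)

lemma mono_in_loc_kernel_if_infinite: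
  assumes "p \<in> P" "qbar I P (lcls P (q + p) 0) = qbar I P (lcls P q 0)"
  shows "mono q \<in> loc_kernel I (IrhoP P L \<sigma>)"
proof -
  obtain w c where w: "w \<notin> P" "c \<noteq> 0" "mono (q + p + w) - Poly_Mapping.single (q + w) c \<in> I"
    using assms qbar_lcls_eq_iff[OF I, of 0 0 "q + p" q] by (auto simp: simI_def)
  have "(mono (p + w) - Poly_Mapping.single w c) * mono q \<in> I"
    using w(3) by (simp add: left_diff_distrib mult_single add.commute add.left_commute)
  \<comment> \<open>Membership would make \<open>(p + w) - w\<close> a unit, although
    \<open>p + w\<close> lies in \<open>P\<close>.\<close>
  moreover have "mono (p + w) - Poly_Mapping.single w c \<notin> IrhoP P L \<sigma>"
  proof
    assume "mono (p + w) - Poly_Mapping.single w c \<in> IrhoP P L \<sigma>"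
    then have "lcls P (p + w) w \<in> GP P"
      using IrhoP_binomialD[OF character _ w(1,2)] L_subset_GP by blast
    then show False using w assms by (simp add: lcls_in_GP_iff)
  qed
  ultimately show ?thesis by (auto simp: loc_kernel_def)
qed

lemma mono_in_loc_kernel_if_in_IP:
  assumes "lemb P (mono q) \<in> IP P I"
  shows "mono q \<in> loc_kernel I (IrhoP P L \<sigma>)"
proof -
  obtain u f where u: "u \<notin> P" "f \<in> I" "lfrac P 0 (mono q) = lfrac P u f"
    using assms by (auto simp: IP_eq[OF I] lemb_eq_lfrac)
  then obtain w where w: "w \<notin> P" "mono (w + u) * mono q = mono (w + 0) * f"
    using lfrac_eqD[of 0 u] by auto
  have "mono (w + u) * mono q \<in> I" unfolding w(2) using u I by (intro ideal_mult)
  moreover have "mono (w + u) \<notin> IrhoP P L \<sigma>"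
    using w u by (intro mono_notin_IrhoP[OF character]) simp
  ultimately show ?thesis by (auto simp: loc_kernel_def)
qed

section \<open>Identifying the character at \<open>q\<close> with the restriction of
  \<open>\<sigma>\<close>\<close>

context
  fixes q :: 'q
  assumes notin_kernel: "mono q \<notin> loc_kernel I (IrhoP P L \<sigma>)"
begin

lemma colon_subset_IrhoP: "s * mono q \<in> I \<Longrightarrow> s \<in> IrhoP P L \<sigma>"
  using notin_kernel by (auto simp: loc_kernel_def)

text \<open>Dividing by the monomial at \<open>q\<close> leaves a binomial in the colon ideal, hence
  in the prime ideal, where \<open>IrhoP_binomialD\<close> reads off its coefficient.\<close>

lemma binomial_character:
  assumes "mono (a + q) - Poly_Mapping.single (u + q) c \<in> I" "u \<notin> P" "c \<noteq> 0"
  shows "a \<notin> P \<and> lcls P a u \<in> L \<and> \<sigma> (lcls P a u) = c"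
proof -
  have "(mono a - Poly_Mapping.single u c) * mono q \<in> I"
    using assms by (simp add: left_diff_distrib mult_single)
  then have *: "lcls P a u \<in> L \<and> \<sigma> (lcls P a u) = c"
    using assms IrhoP_binomialD[OF character] colon_subset_IrhoP by blast
  then have "lcls P a u \<in> GP P" using L_subset_GP by blast
  with * show ?thesis using assms by (simp add: lcls_in_GP_iff)
qed

lemma lcls_in_Kq_iff:
  assumes "a \<notin> P" "u \<notin> P"
  shows "lcls P a u \<in> Kq I P q \<longleftrightarrow> (\<exists>w. w \<notin> P \<and> simI I (a + q + w) (u + q + w))"
  using assms qbar_lcls_eq_iff[OF I, of u 0 "a + q" q]
  by (simp add: Kq_def lcls_in_GP_iff ladd_lcls add.commute[of q u])

lemma lcls_in_KqI: "a \<notin> P \<Longrightarrow> u \<notin> P \<Longrightarrow> simI I (a + q) (u + q) \<Longrightarrow> lcls P a u \<in> Kq I P q"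
  using lcls_in_Kq_iff by (metis add_0_right zero_notin)

text \<open>Adding the auxiliary \<open>w\<close> of \<open>barrel\<close> to both parts of a
  representative of \<open>g\<close> yields one whose binomial lies in \<open>I\<close> itself; its
  coefficient is then forced to be \<open>\<sigma> g\<close>.\<close>

lemma Kq_E:
  assumes "g \<in> Kq I P q"
  obtains a u where "g = lcls P a u" "a \<notin> P" "u \<notin> P" "g \<in> L" "\<sigma> g \<noteq> 0"
    "mono (a + q) - Poly_Mapping.single (u + q) (\<sigma> g) \<in> I"
proof -
  have "g \<in> GP P" using assms by (simp add: Kq_def)
  then obtain a u where g: "g = lcls P a u" "a \<notin> P" "u \<notin> P" using GP_E by blast
  then obtain w c where w: "w \<notin> P" "c \<noteq> 0" "mono (a + q + w) - Poly_Mapping.single (u + q + w) c \<in> I"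
    using assms lcls_in_Kq_iff by (auto simp: simI_def)
  have g': "g = lcls P (a + w) (u + w)" using g w by (simp add: lcls_shift)
  have m: "mono ((a + w) + q) - Poly_Mapping.single ((u + w) + q) c \<in> I"
    using w(3) by (simp add: ac_simps)
  then have "g \<in> L \<and> \<sigma> g = c"
    unfolding g' using binomial_character[of "a + w" "u + w" c] g w by simp
  then show thesis using that[of "a + w" "u + w"] g g' w m by simp
qed

lemma Kq_subset_L: "Kq I P q \<subseteq> L"
  by (blast elim: Kq_E)

lemma subgroup_Kq: "subgroup_GP P (Kq I P q)"
  unfolding subgroup_GP_def
proof (intro conjI ballI)
  show "Kq I P q \<subseteq> GP P" by (auto simp: Kq_def)
  show "lzero P \<in> Kq I P q" unfolding lzero_def
    using simI_refl[OF I] by (intro lcls_in_KqI) auto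
next
  fix g assume g: "g \<in> Kq I P q"
  obtain a u where gE: "g = lcls P a u" "a \<notin> P" "u \<notin> P" "\<sigma> g \<noteq> 0"
    "mono (a + q) - Poly_Mapping.single (u + q) (\<sigma> g) \<in> I" by (rule Kq_E[OF g])
  then have sg: "simI I (a + q) (u + q)" by (auto simp: simI_def)
  then have "lcls P u a \<in> Kq I P q" using gE simI_sym[OF I] by (intro lcls_in_KqI) auto
  moreover have "ladd P g (lcls P u a) = lzero P"
    using gE lcls_self[of "a + u"] by (simp add: ladd_lcls add.commute[of u a])
  ultimately show "\<exists>h\<in>Kq I P q. ladd P g h = lzero P" by blast
  fix h assume h: "h \<in> Kq I P q"
  obtain b v where hE: "h = lcls P b v" "b \<notin> P" "v \<notin> P" "\<sigma> h \<noteq> 0"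
    "mono (b + q) - Poly_Mapping.single (v + q) (\<sigma> h) \<in> I" by (rule Kq_E[OF h])
  then have sh: "simI I (b + q) (v + q)" by (auto simp: simI_def)
  have "simI I (a + b + q) (u + b + q)" using simI_add[OF I sg, of b] by (simp add: ac_simps)
  moreover have "simI I (u + b + q) (u + v + q)" using simI_add[OF I sh, of u] by (simp add: ac_simps)
  ultimately have "simI I (a + b + q) (u + v + q)" by (rule simI_trans[OF I])
  then show "ladd P g h \<in> Kq I P q" using gE hE by (simp add: ladd_lcls lcls_in_KqI)
qed

text \<open>The value \<open>undefined\<close> off \<open>Kq I P q\<close> matches the normalization
  in \<open>rhoq\<close>, so that equality holds as functions.\<close>

definition sigma_Kq :: "('q \<times> 'q) set \<Rightarrow> 'k" where
  "sigma_Kq g = (if g \<in> Kq I P q then \<sigma> g else undefined)"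

lemma character_sigma_Kq: "is_character P (Kq I P q) sigma_Kq"
  using character subgroup_Kq Kq_subset_L unfolding is_character_def
  by (auto simp: sigma_Kq_def subgroup_GP_def[of _ "Kq I P q"] subset_iff)

lemma Kq_subset_GP: "Kq I P q \<subseteq> GP P"
  by (auto simp: Kq_def)

lemma Irho_subset_lcolon: "Irho P (Kq I P q) sigma_Kq \<subseteq> lcolon P (IP P I) q"
proof -
  have "(\<lambda>Y. lmon (ladd P g v) Y - sigma_Kq g * lmon v Y) \<in> lcolon P (IP P I) q"
    if g: "g \<in> Kq I P q" and v: "v \<in> QP P" for g v
  proof -
    obtain a u where gE: "g = lcls P a u" "a \<notin> P" "u \<notin> P"
      "mono (a + q) - Poly_Mapping.single (u + q) (\<sigma> g) \<in> I" by (rule Kq_E[OF g])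
    obtain b w where vE: "v = lcls P b w" "w \<notin> P" using QP_E[OF v] .
    have "mono b * (mono (a + q) - Poly_Mapping.single (u + q) (\<sigma> g)) \<in> I"
      using gE I by (intro ideal_mult)
    then have "(mono (a + b) - Poly_Mapping.single (u + b) (\<sigma> g)) * mono q \<in> I"
      by (simp add: algebra_simps mult_single)
    then have "lfrac P (u + w) ((mono (a + b) - Poly_Mapping.single (u + b) (\<sigma> g)) * mono q) \<in> IP P I"
      using gE vE by (intro lfrac_in_IP) simp_all
    then have "lfrac P (u + w) (mono (a + b) - Poly_Mapping.single (u + b) (\<sigma> g)) \<in> lcolon P (IP P I) q"
      using gE vE by (simp add: lcolon_def lmon_eq_lfrac lfrac_mult)
    moreover have "sigma_Kq g = \<sigma> g" using g by (simp add: sigma_Kq_def)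
    ultimately show ?thesis
      unfolding vE(1) using Irho_generator_eq_lfrac[OF gE(3) vE(2), of a b "\<sigma> g"] gE(1) by simp
  qed
  then show ?thesis unfolding Irho_def by (intro lgen_least[OF lideal_lcolon[OF lideal_IP[OF I]]]) blast
qed

text \<open>Induction on the number of terms. Terms in \<open>P\<close> go to \<open>mP P\<close>. A
  term at \<open>a\<close> outside \<open>P\<close> either absorbs a congruent term modulo
  \<open>Irho\<close>, or is alone in its class; then the grading of \<open>I\<close> would put its
  monomial into the prime ideal.\<close>

lemma lfrac_in_lsum_Irho:
  assumes "s * mono q \<in> I" "u \<notin> P"
  shows "lfrac P u s \<in> lsum (Irho P (Kq I P q) sigma_Kq) (mP P)"
  using assms(1)
proof (induction "card (Poly_Mapping.keys s)" arbitrary: s rule: less_induct)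
  case less
  let ?T = "lsum (Irho P (Kq I P q) sigma_Kq) (mP P)"
  show ?case
  proof (cases "Poly_Mapping.keys s \<subseteq> P")
    case True
    then show ?thesis using lfrac_in_mP[OF assms(2)] mP_subset_lsum[OF Kq_subset_GP] by blast
  next
    case False
    then obtain a where a: "a \<in> Poly_Mapping.keys s" "a \<notin> P" by blast
    show ?thesis
    proof (cases "\<exists>b\<in>Poly_Mapping.keys s. b \<noteq> a \<and> simI I (b + q) (a + q)")
      case True
      then obtain b c where b: "b \<in> Poly_Mapping.keys s" "b \<noteq> a" "c \<noteq> 0"
        "mono (b + q) - Poly_Mapping.single (a + q) c \<in> I" by (auto simp: simI_def)
      define k where "k = Poly_Mapping.lookup s b"
      \<comment> \<open>The weight is \<open>k * c\<close> because the monomial at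
        \<open>b + q\<close> is \<open>c\<close> times that at \<open>a + q\<close> modulo
        \<open>I\<close>.\<close>
      define s' where "s' = s - Poly_Mapping.single b k + Poly_Mapping.single a (k * c)"
      have "card (Poly_Mapping.keys s') < card (Poly_Mapping.keys s)"
        unfolding s'_def k_def using a b by (intro card_keys_merge_less) auto
      moreover have "s' * mono q = s * mono q
          - Poly_Mapping.single 0 k * (mono (b + q) - Poly_Mapping.single (a + q) c)"
        by (simp add: s'_def algebra_simps mult_single)
      then have "s' * mono q \<in> I"
        using less.prems b I by (simp add: ideal_minus ideal_mult)
      ultimately have IH: "lfrac P u s' \<in> ?T" using less.hyps by blast
      have g: "b \<notin> P" "\<sigma> (lcls P b a) = c" using binomial_character[OF b(4) a(2) b(3)] by auto
      have gK: "lcls P b a \<in> Kq I P q" using b a g by (intro lcls_in_KqI) (auto simp: simI_def)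
      then have "(\<lambda>Y. lmon (ladd P (lcls P b a) (lcls P a u)) Y
          - sigma_Kq (lcls P b a) * lmon (lcls P a u) Y) \<in> Irho P (Kq I P q) sigma_Kq"
        unfolding Irho_def using assms(2)
        by (intro subsetD[OF lgen_superset]) (use QP_lcls in blast)
      moreover have "sigma_Kq (lcls P b a) = c" using gK g by (simp add: sigma_Kq_def)
      ultimately have "lfrac P (a + u) (mono (b + a) - Poly_Mapping.single (a + a) c)
          \<in> Irho P (Kq I P q) sigma_Kq"
        using Irho_generator_eq_lfrac[OF a(2) assms(2), of b a c] by simp
      moreover have "mono (b + a) - Poly_Mapping.single (a + a) c
          = mono a * (mono b - Poly_Mapping.single a c)"
        by (simp add: algebra_simps mult_single)
      ultimately have "lfrac P u (mono b - Poly_Mapping.single a c) \<in> Irho P (Kq I P q) sigma_Kq"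
        using lfrac_shift[OF assms(2) a(2), of "mono b - Poly_Mapping.single a c"]
        by (simp add: add.commute[of u a])
      then have "lmul P (lfrac P 0 (Poly_Mapping.single 0 k)) (lfrac P u (mono b - Poly_Mapping.single a c))
          \<in> Irho P (Kq I P q) sigma_Kq"
        by (intro lideal_lmul[OF lideal_Irho[OF Kq_subset_GP]]) simp
      then have i: "lfrac P u (Poly_Mapping.single b k - Poly_Mapping.single a (k * c))
          \<in> Irho P (Kq I P q) sigma_Kq"
        using assms(2) by (simp add: lfrac_mult right_diff_distrib mult_single)
      obtain j m where jm: "j \<in> Irho P (Kq I P q) sigma_Kq" "m \<in> mP P" "lfrac P u s' = (\<lambda>X. j X + m X)"
        using lsumE[OF IH] .
      have "s = Poly_Mapping.single b k - Poly_Mapping.single a (k * c) + s'" by (simp add: s'_def)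
      then have "lfrac P u s = (\<lambda>X. lfrac P u (Poly_Mapping.single b k - Poly_Mapping.single a (k * c)) X
          + lfrac P u s' X)" using lfrac_add by metis
      also have "\<dots> = (\<lambda>X. (lfrac P u (Poly_Mapping.single b k - Poly_Mapping.single a (k * c)) X + j X) + m X)"
        by (simp add: jm(3) add.assoc)
      also have "\<dots> \<in> ?T"
        using i jm by (intro lsumI lideal_add[OF lideal_Irho[OF Kq_subset_GP]])
      finally show ?thesis .
    next
      case False
      \<comment> \<open>The class of \<open>a + q\<close>; by the case assumption, its only
        contribution from \<open>mono q * s\<close> is the term of \<open>s\<close> at
        \<open>a\<close>.\<close>
      let ?S = "{y. simI I y (a + q)}" and ?c = "Poly_Mapping.lookup s a"
      have "restr ?S (mono q * s) \<in> I"
      proof (rule binomial_ideal_restr[OF binomial])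
        show "mono q * s \<in> I" using less.prems by (simp add: mult.commute)
        show "p \<in> ?S \<longleftrightarrow> r \<in> ?S" if "simI I p r" for p r
          using simI_sym[OF I that] that simI_trans[OF I] by blast
      qed
      moreover have "restr {y. q + y \<in> ?S} s = Poly_Mapping.single a ?c"
      proof (rule poly_mapping_eqI)
        fix b
        have "simI I (q + a) (a + q)" using simI_refl[OF I] by (simp add: add.commute)
        moreover have "Poly_Mapping.lookup s b = 0" if "b \<noteq> a" "simI I (q + b) (a + q)"
          using False that by (auto simp: in_keys_iff add.commute[of q])
        ultimately show "Poly_Mapping.lookup (restr {y. q + y \<in> ?S} s) b
            = Poly_Mapping.lookup (Poly_Mapping.single a ?c) b"
          by (auto simp: lookup_restr lookup_single when_def)
      qed
      ultimately have "mono q * Poly_Mapping.single a ?c \<in> I"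
        by (simp only: restr_single_mult)
      then have "Poly_Mapping.single a ?c * mono q \<in> I" by (simp only: mult.commute)
      then have "Poly_Mapping.single 0 (inverse ?c) * Poly_Mapping.single a ?c \<in> IrhoP P L \<sigma>"
        by (intro ideal_mult[OF is_ideal_IrhoP] colon_subset_IrhoP)
      then have "mono a \<in> IrhoP P L \<sigma>" using a by (simp add: mult_single in_keys_iff)
      then show ?thesis using mono_notin_IrhoP[OF character a(2)] by blast
    qed
  qed
qed

text \<open>Clearing denominators: after multiplication by a monomial outside \<open>P\<close>, the
  numerator itself multiplies \<open>mono q\<close> into \<open>I\<close>.\<close>

lemma lcolon_subset_lsum_Irho: "lcolon P (IP P I) q \<subseteq> lsum (Irho P (Kq I P q) sigma_Kq) (mP P)"
proof
  fix c assume c: "c \<in> lcolon P (IP P I) q"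
  then have "c \<in> RP P" by (simp add: lcolon_def)
  then obtain u f where u: "u \<notin> P" "c = lfrac P u f" using RP_E by blast
  have "lfrac P u (f * mono q) \<in> IP P I"
    using c u by (simp add: lcolon_def lmon_eq_lfrac lfrac_mult)
  then obtain v h where v: "v \<notin> P" "h \<in> I" "lfrac P u (f * mono q) = lfrac P v h"
    by (auto simp: IP_eq[OF I])
  obtain w where w: "w \<notin> P" "mono (w + v) * (f * mono q) = mono (w + u) * h"
    using lfrac_eqD[OF u(1) v(1,3)] by blast
  have "mono (w + v) * f * mono q \<in> I"
    using w(2) ideal_mult[OF I v(2), of "mono (w + u)"] by (simp add: mult.assoc)
  then have "lfrac P (u + (w + v)) (mono (w + v) * f) \<in> lsum (Irho P (Kq I P q) sigma_Kq) (mP P)"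
    using u v w by (intro lfrac_in_lsum_Irho) auto
  then show "c \<in> lsum (Irho P (Kq I P q) sigma_Kq) (mP P)"
    using u v w lfrac_shift[of u "w + v" f] by simp
qed

lemma lsum_lcolon_eq: "lsum (lcolon P (IP P I) q) (mP P) = lsum (Irho P (Kq I P q) sigma_Kq) (mP P)"
proof
  show "lsum (Irho P (Kq I P q) sigma_Kq) (mP P) \<subseteq> lsum (lcolon P (IP P I) q) (mP P)"
    using Irho_subset_lcolon by (auto simp: lsum_def)
  show "lsum (lcolon P (IP P I) q) (mP P) \<subseteq> lsum (Irho P (Kq I P q) sigma_Kq) (mP P)"
  proof
    fix x assume "x \<in> lsum (lcolon P (IP P I) q) (mP P)"
    then obtain c m where c: "c \<in> lcolon P (IP P I) q" and m: "m \<in> mP P" and x: "x = (\<lambda>X. c X + m X)"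
      by (rule lsumE)
    have "c \<in> lsum (Irho P (Kq I P q) sigma_Kq) (mP P)" using c lcolon_subset_lsum_Irho by blast
    then obtain i n where i: "i \<in> Irho P (Kq I P q) sigma_Kq" and n: "n \<in> mP P" and c: "c = (\<lambda>X. i X + n X)"
      by (rule lsumE)
    have "(\<lambda>X. i X + (n X + m X)) \<in> lsum (Irho P (Kq I P q) sigma_Kq) (mP P)"
      using i n m by (intro lsumI lideal_add[OF lideal_mP])
    then show "x \<in> lsum (Irho P (Kq I P q) sigma_Kq) (mP P)" by (simp add: x c add.assoc)
  qed
qed

text \<open>Existence is \<open>lsum_lcolon_eq\<close>. Uniqueness on \<open>Kq I P q\<close> comes
  from \<open>character_eq_if_lsum_Irho_eq\<close>, and elsewhere from the fixed default
  value.\<close>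

lemma rhoq_eq_sigma_Kq: "rhoq I P q = sigma_Kq"
  unfolding rhoq_def
proof (rule the_equality, intro conjI)
  show "is_character P (Kq I P q) sigma_Kq" by (rule character_sigma_Kq)
  show "\<forall>g. g \<notin> Kq I P q \<longrightarrow> sigma_Kq g = undefined" by (simp add: sigma_Kq_def)
  show "lsum (lcolon P (IP P I) q) (mP P) = lsum (Irho P (Kq I P q) sigma_Kq) (mP P)"
    by (rule lsum_lcolon_eq)
next
  fix \<rho> :: "('q \<times> 'q) set \<Rightarrow> 'k"
  assume \<rho>: "is_character P (Kq I P q) \<rho> \<and> (\<forall>g. g \<notin> Kq I P q \<longrightarrow> \<rho> g = undefined) \<and>
     lsum (lcolon P (IP P I) q) (mP P) = lsum (Irho P (Kq I P q) \<rho>) (mP P)"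
  show "\<rho> = sigma_Kq"
  proof
    fix g
    show "\<rho> g = sigma_Kq g"
    proof (cases "g \<in> Kq I P q")
      case True
      with \<rho> show ?thesis
        by (intro character_eq_if_lsum_Irho_eq[OF _ character_sigma_Kq]) (auto simp: lsum_lcolon_eq)
    next
      case False
      with \<rho> show ?thesis by (simp add: sigma_Kq_def)
    qed
  qed
qed

lemma rhoq_eq: "Kq I P q \<subseteq> L \<and> (\<forall>g\<in>Kq I P q. rhoq I P q g = \<sigma> g)"
  using Kq_subset_L by (simp add: rhoq_eq_sigma_Kq sigma_Kq_def)

end

lemma Msigma_subset_loc_kernel: "Msigma P L \<sigma> I \<subseteq> loc_kernel I (IrhoP P L \<sigma>)"
proof
  have ker: "is_ideal (loc_kernel I (IrhoP P L \<sigma>))" by (rule is_ideal_loc_kernel[OF I prime_ideal])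
  fix f assume "f \<in> Msigma P L \<sigma> I"
  then obtain A c where A: "finite A" "f = (\<Sum>q\<in>A. Poly_Mapping.single q (c q))"
    "\<And>q. q \<in> A \<Longrightarrow> \<not> (Kq I P q \<subseteq> L \<and> (\<forall>g\<in>Kq I P q. rhoq I P q g = \<sigma> g)) \<or> lemb P (mono q) \<in> IP P I"
    unfolding Msigma_def mono_span_def by blast
  have "Poly_Mapping.single q (c q) \<in> loc_kernel I (IrhoP P L \<sigma>)" if "q \<in> A" for q
  proof -
    \<comment> \<open>Outside its context \<open>rhoq_eq\<close> has the premise that
      \<open>mono q\<close> is not in the kernel; here it is used contrapositively.\<close>
    have "mono q \<in> loc_kernel I (IrhoP P L \<sigma>)"
      using A(3)[OF that] rhoq_eq mono_in_loc_kernel_if_in_IP by blast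
    then have "Poly_Mapping.single 0 (c q) * mono q \<in> loc_kernel I (IrhoP P L \<sigma>)"
      by (rule ideal_mult[OF ker])
    then show ?thesis by (simp add: mult_single)
  qed
  with A(1) have "(\<Sum>q\<in>A. Poly_Mapping.single q (c q)) \<in> loc_kernel I (IrhoP P L \<sigma>)"
    using ker by (induction A rule: finite_induct) (auto simp: is_ideal_def)
  then show "f \<in> loc_kernel I (IrhoP P L \<sigma>)" by (simp add: A(2))
qed

lemma Minf_subset_loc_kernel: "Minf P I \<subseteq> loc_kernel I (IrhoP P L \<sigma>)"
  unfolding Minf_def
  using mono_in_loc_kernel_if_infinite
  by (intro gen_ideal_least[OF is_ideal_loc_kernel[OF I prime_ideal]]) blast

lemma ideal_subset_loc_kernel: "I \<subseteq> loc_kernel I (IrhoP P L \<sigma>)"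
  using mono_notin_IrhoP[OF character zero_notin]
  by (auto simp: loc_kernel_def intro!: exI[of _ 1])

end

end

theorem theorem14p9:
  fixes I :: "('q::comm_monoid_add \<Rightarrow>\<^sub>0 'k::field) set"
    and P :: "'q set"
    and L :: "('q \<times> 'q) set set"
    and \<sigma> :: "('q \<times> 'q) set \<Rightarrow> 'k"
  assumes "fin_gen_monoid TYPE('q)"
    and "is_ideal I" and "binomial_ideal I"
    and "monoid_prime P"
    and "is_character P L \<sigma>"
    and "is_prime_ideal (IrhoP P L \<sigma>)"
  shows "{a + b + c | a b c. a \<in> I \<and> b \<in> Minf P I \<and> c \<in> Msigma P L \<sigma> I}
           \<subseteq> loc_kernel I (IrhoP P L \<sigma>)"
proof clarify
  note hyps = assms(4,2,3,5,6)
  fix a b c assume "a \<in> I" "b \<in> Minf P I" "c \<in> Msigma P L \<sigma> I"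
  then have "a \<in> loc_kernel I (IrhoP P L \<sigma>)" "b \<in> loc_kernel I (IrhoP P L \<sigma>)"
    "c \<in> loc_kernel I (IrhoP P L \<sigma>)"
    using ideal_subset_loc_kernel[OF hyps] Minf_subset_loc_kernel[OF hyps]
      Msigma_subset_loc_kernel[OF hyps] by auto
  then show "a + b + c \<in> loc_kernel I (IrhoP P L \<sigma>)"
    by (intro ideal_add is_ideal_loc_kernel[OF assms(2,6)])
qed

end
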